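(* Let $\mu$ be a critical offspring distribution (a probability measure on $\{0,1,2,\dots\}$ with mean $1$) with finite non-zero variance. Let $T_\infty$ be a $\mu$-Galton--Watson plane tree conditioned to survive forever and let $\mathscr{C}_\infty=\mathsf{Causal}(T_\infty)$ be the associated causal map. Then there exists a constant $C$ such that almost surely, for all $r$ sufficiently large, $$\frac1r\,\mathsf{Girth}_r(\mathscr{C}_\infty)\ge e^{-C\sqrt{\log r}}.$$
   Context: For a locally finite plane tree $\tau$ with root $\rho$, the height of a vertex is its distance to $\rho$ in $\tau$; $[\tau]_k$ is the (plane) subtree spanned by the vertices of height at most $k$, and $\partial[\tau]_k$ is the set of vertices of height exactly $k$. The plane structure gives a cyclic left-to-right ordering of the vertices of each level; $\mathsf{Causal}(\tau)$ is the graph (planar map) obtained from $\tau$ by adding, for every level, the "horizontal" edges linking successive vertices in the cyclic ordering of that level (possible loops and multiple edges are irrelevant for distances). For $r\ge 1$, $$\mathsf{Girth}_r(\mathsf{Causal}(\tau)) := \sup\{ d(x,y) : x,y\in\partial[\tau]_r\},\qquad \sup\varnothing=0,$$ where $d$ is the graph distance in $\mathsf{Causal}(\tau)$. For critical $\mu$ with $\mu\ne\delta_1$, let $T$ be a $\mu$-Galton--Watson plane tree. The $\mu$-Galton--Watson tree conditioned to survive forever is the random infinite, locally finite plane tree $T_\infty$ whose law is characterized by $\mathbb{E}[F([T_\infty]_n)]=\mathbb{E}[F([T]_n)\,\#\partial[T]_n]$ for every $n\ge 0$ and every nonnegative function $F$ on finite plane trees. *)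

theory Defs
  imports "HOL-Probability.Probability"
begin

text \<open>Plane trees in Ulam--Harris--Neveu coding: vertices are words over the naturals, the root
  is the empty word, and the children of \<open>u\<close> are \<open>u @ [0], u @ [1], \<dots>\<close> from left to right.\<close>

definition plane_tree :: "nat list set \<Rightarrow> bool" where
  "plane_tree \<tau> \<longleftrightarrow>
     [] \<in> \<tau> \<and>
     (\<forall>u i. u @ [i] \<in> \<tau> \<longrightarrow> u \<in> \<tau>) \<and>
     (\<forall>u i j. u @ [i] \<in> \<tau> \<longrightarrow> j < i \<longrightarrow> u @ [j] \<in> \<tau>)"

definition locally_finite :: "nat list set \<Rightarrow> bool" where
  "locally_finite \<tau> \<longleftrightarrow> (\<forall>u\<in>\<tau>. finite {i. u @ [i] \<in> \<tau>})"

definition truncate_tree :: "nat \<Rightarrow> nat list set \<Rightarrow> nat list set" where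
  "truncate_tree k \<tau> = {u \<in> \<tau>. length u \<le> k}"

definition level :: "nat \<Rightarrow> nat list set \<Rightarrow> nat list set" where
  "level k \<tau> = {u \<in> \<tau>. length u = k}"


text \<open>\<open>lex less_than\<close> relates only words of equal length, that is, it is the left-to-right order
  within each level. The second disjunct closes a level up cyclically; it yields a loop when the
  level has one vertex.\<close>

definition next_in_level :: "nat list set \<Rightarrow> nat list \<Rightarrow> nat list \<Rightarrow> bool" where
  "next_in_level \<tau> u v \<longleftrightarrow>
     u \<in> \<tau> \<and> v \<in> \<tau> \<and> length u = length v \<and>
     ((u, v) \<in> lex less_than \<and>
        \<not> (\<exists>w\<in>\<tau>. (u, w) \<in> lex less_than \<and> (w, v) \<in> lex less_than)
      \<or> \<not> (\<exists>w\<in>\<tau>. (u, w) \<in> lex less_than) \<and> \<not> (\<exists>w\<in>\<tau>. (w, v) \<in> lex less_than))"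

text \<open>The causal graph, as a symmetric adjacency relation; multiplicities of edges are dropped.\<close>

definition causal :: "nat list set \<Rightarrow> (nat list \<times> nat list) set" where
  "causal \<tau> =
     (let E = {(u, u @ [i]) | u i. u @ [i] \<in> \<tau>} \<union> {(u, v). next_in_level \<tau> u v}
      in E \<union> E\<inverse>)"

text \<open>Least number of edges of a walk, for connected points.\<close>

definition graph_dist :: "('v \<times> 'v) set \<Rightarrow> 'v \<Rightarrow> 'v \<Rightarrow> nat" where
  "graph_dist E x y = (LEAST n. (x, y) \<in> E ^^ n)"

text \<open>On \<^typ>\<open>nat\<close>, the supremum of the empty set is 0.\<close>

definition girth :: "nat \<Rightarrow> nat list set \<Rightarrow> nat" where
  "girth r \<tau> = Sup {graph_dist (causal \<tau>) x y | x y. x \<in> level r \<tau> \<and> y \<in> level r \<tau>}"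


text \<open>The \<open>\<sigma>\<close>-algebra of the local topology on locally finite plane trees.\<close>

definition tree_space :: "nat list set measure" where
  "tree_space =
     sigma {\<tau>. plane_tree \<tau> \<and> locally_finite \<tau>}
       {{\<tau>. plane_tree \<tau> \<and> locally_finite \<tau> \<and> truncate_tree n \<tau> = s} | n s. True}"

text \<open>The tree in which every vertex \<open>u\<close> has exactly \<open>K u\<close> children.\<close>

definition offspring_tree :: "(nat list \<Rightarrow> nat) \<Rightarrow> nat list set" where
  "offspring_tree K = {u. \<forall>i<length u. u ! i < K (take i u)}"

definition GW_law :: "nat pmf \<Rightarrow> nat list set measure" where
  "GW_law \<mu> = distr (\<Pi>\<^sub>M u\<in>UNIV. measure_pmf \<mu>) tree_space offspring_tree"

text \<open>\<open>T\<close> is a \<open>\<mu>\<close>-Galton--Watson tree conditioned to survive forever, for critical \<open>\<mu>\<close>.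
  Taking for \<open>F\<close> the indicator of trees reaching height \<open>n\<close> shows that \<open>T\<close> is almost surely infinite.\<close>

definition GW_surviving :: "nat pmf \<Rightarrow> 'a measure \<Rightarrow> ('a \<Rightarrow> nat list set) \<Rightarrow> bool" where
  "GW_surviving \<mu> M T \<longleftrightarrow>
     T \<in> M \<rightarrow>\<^sub>M tree_space \<and>
     (\<forall>n. \<forall>F :: nat list set \<Rightarrow> ennreal.
        (\<integral>\<^sup>+ \<omega>. F (truncate_tree n (T \<omega>)) \<partial>M) =
        (\<integral>\<^sup>+ \<tau>. F (truncate_tree n \<tau>) * of_nat (card (level n \<tau>)) \<partial>GW_law \<mu>))"


text \<open>Well-definedness: distances in the causal graph are attained, and the Galton--Watson law is
  the image of a measurable map.\<close>

lemma plane_tree_parent: "plane_tree \<tau> \<Longrightarrow> u @ [i] \<in> \<tau> \<Longrightarrow> u \<in> \<tau>"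
  unfolding plane_tree_def by blast

lemma causal_connected_root:
  assumes "plane_tree \<tau>" "u \<in> \<tau>"
  shows "(u, []) \<in> (causal \<tau>)\<^sup>*"
  using assms(2)
proof (induction u rule: rev_induct)
  case (snoc i u)
  then have "u \<in> \<tau>" using plane_tree_parent[OF assms(1)] by blast
  moreover have "(u @ [i], u) \<in> causal \<tau>"
    using snoc.prems by (auto simp: causal_def Let_def)
  ultimately show ?case using snoc.IH by (meson converse_rtrancl_into_rtrancl)
qed simp

lemma graph_dist_causal_attained:
  assumes "plane_tree \<tau>" "u \<in> \<tau>" "v \<in> \<tau>"
  shows "(u, v) \<in> causal \<tau> ^^ graph_dist (causal \<tau>) u v"
proof -
  have "sym (causal \<tau>)" by (auto simp: causal_def Let_def sym_def)
  then have "([], v) \<in> (causal \<tau>)\<^sup>*"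
    using causal_connected_root[OF assms(1,3)] by (meson sym_rtrancl symD)
  then have "(u, v) \<in> (causal \<tau>)\<^sup>*"
    using causal_connected_root[OF assms(1,2)] by (meson rtrancl_trans)
  then obtain n where "(u, v) \<in> causal \<tau> ^^ n" by (meson rtrancl_imp_relpow)
  then show ?thesis unfolding graph_dist_def by (rule LeastI)
qed

lemma offspring_tree_snoc:
  "u @ [i] \<in> offspring_tree K \<longleftrightarrow> u \<in> offspring_tree K \<and> i < K u"
  by (auto simp: offspring_tree_def nth_append less_Suc_eq)

lemma plane_tree_offspring_tree: "plane_tree (offspring_tree K)"
  unfolding plane_tree_def
proof (intro conjI allI impI)
  show "[] \<in> offspring_tree K" by (simp add: offspring_tree_def)
qed (simp_all add: offspring_tree_snoc)

lemma locally_finite_offspring_tree: "locally_finite (offspring_tree K)"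
  by (simp add: locally_finite_def offspring_tree_snoc)

lemma finite_level:
  assumes "plane_tree \<tau>" "locally_finite \<tau>"
  shows "finite (level n \<tau>)"
proof (induction n)
  case 0
  have "level 0 \<tau> \<subseteq> {[]}" by (auto simp: level_def)
  then show ?case by (rule finite_subset) simp
next
  case (Suc n)
  have "level (Suc n) \<tau> \<subseteq> (\<Union>u\<in>level n \<tau>. (\<lambda>i. u @ [i]) ` {i. u @ [i] \<in> \<tau>})"
  proof
    fix w assume w: "w \<in> level (Suc n) \<tau>"
    then obtain u i where ui: "w = u @ [i]" by (cases w rule: rev_cases) (auto simp: level_def)
    with w have "u @ [i] \<in> \<tau>" "length u = n" by (simp_all add: level_def)
    moreover from this have "u \<in> \<tau>" using plane_tree_parent[OF assms(1)] by blast
    ultimately show "w \<in> (\<Union>u\<in>level n \<tau>. (\<lambda>i. u @ [i]) ` {i. u @ [i] \<in> \<tau>})"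
      using ui by (auto simp: level_def)
  qed
  moreover have "finite (\<Union>u\<in>level n \<tau>. (\<lambda>i. u @ [i]) ` {i. u @ [i] \<in> \<tau>})"
    using Suc assms(2) by (auto simp: locally_finite_def level_def)
  ultimately show ?case by (rule finite_subset)
qed

lemma measurable_offspring_tree:
  "offspring_tree \<in> (\<Pi>\<^sub>M u\<in>UNIV. measure_pmf \<mu>) \<rightarrow>\<^sub>M tree_space"
  unfolding tree_space_def
proof (rule measurable_measure_of)
  show "offspring_tree \<in> space (\<Pi>\<^sub>M u\<in>UNIV. measure_pmf \<mu>)
          \<rightarrow> {\<tau>. plane_tree \<tau> \<and> locally_finite \<tau>}"
    by (auto simp: plane_tree_offspring_tree locally_finite_offspring_tree)
next
  fix A assume "A \<in> {{\<tau>. plane_tree \<tau> \<and> locally_finite \<tau> \<and> truncate_tree n \<tau> = s} | n s. True}"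
  then obtain n s where A: "A = {\<tau>. plane_tree \<tau> \<and> locally_finite \<tau> \<and> truncate_tree n \<tau> = s}"
    by blast
  let ?P = "\<Pi>\<^sub>M u\<in>UNIV. measure_pmf \<mu> :: nat measure"
  have eq: "offspring_tree -` A \<inter> space ?P =
    {K \<in> space ?P. \<forall>u. ((\<forall>i\<in>{..<length u}. u ! i < K (take i u)) \<and> length u \<le> n) = (u \<in> s)}"
    by (auto simp: A plane_tree_offspring_tree locally_finite_offspring_tree)
       (auto simp: truncate_tree_def offspring_tree_def)
  have [measurable]: "Measurable.pred ?P (\<lambda>K. u ! i < K (take i u))" for u :: "nat list" and i
    by (rule measurable_compose[OF measurable_component_singleton]) auto
  show "offspring_tree -` A \<inter> space ?P \<in> sets ?P"
    unfolding eq by measurable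
qed auto

end

theory Submission
  imports Defs "HOL-Real_Asymp.Real_Asymp"
begin

text \<open>Call a block of \<open>A * H\<close> consecutive vertices of a level, with \<open>A\<close> a large constant, good for
  \<open>l\<close> if a path inside the strip of height \<open>2 * H\<close> above it needs \<open>l\<close> vertices to traverse the
  descendants of the block from left to right. Since a critical tree with finite variance keeps
  about \<open>A * H\<close> descendants of the block on each level of that strip, a block is good for \<open>l = 1\<close>
  with probability at least \<open>1 / 2\<close>. At the scale \<open>16 * q * H\<close>, a path with fewer than \<open>H / 2\<close> steps
  stays in one of \<open>32 * q\<close> layers of height \<open>2 * H\<close>; the layer contains about \<open>16 * q\<close> independent blocks
  of scale \<open>H\<close>, each with probability at least \<open>1 / 2\<close> costing \<open>l\<close> vertices. Hence scale \<open>H\<close> and cost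
  \<open>l\<close> give scale \<open>16 * q * H\<close> and cost \<open>min (q * l) (H / 2)\<close>. Starting from \<open>H = 2 * q\<close>, \<open>l = 1\<close> this
  reaches scale \<open>2 * q * (16 * q) ^ j\<close> at cost \<open>q ^ j\<close>, and the loss is \<open>exp (O(sqrt (ln r)))\<close> for \<open>q\<close> about
  \<open>exp (sqrt (ln r))\<close> and \<open>j\<close> about \<open>sqrt (ln r)\<close>.

  In the conditioned tree, level \<open>h\<close> has at least \<open>h\<close> divided by a power of \<open>ln h\<close> vertices, so that it
  consists of many such blocks when \<open>H\<close> is about \<open>r * exp (- sqrt (ln r))\<close>. A good block in either half
  of level \<open>r - H\<close> separates two vertices of level \<open>r\<close> on both sides of the cyclic order. The failure
  probability for the unconditioned tree is smaller than every power of \<open>1 / r\<close> one may ask for, which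
  absorbs the density \<open>card (level n)\<close> of the conditioned law.\<close>

section \<open>Wide strips\<close>

abbreviation left_of :: "nat list \<Rightarrow> nat list \<Rightarrow> bool" (infix "\<lhd>" 50) where
  "u \<lhd> v \<equiv> (u, v) \<in> lex less_than"

lemma left_of_length: "u \<lhd> v \<Longrightarrow> length u = length v"
  by (simp add: lexord_lex)

lemma left_of_irrefl: "\<not> u \<lhd> u"
  using irrefl_lex[of less_than] by (auto simp: irrefl_def)

lemma left_of_trans: "u \<lhd> v \<Longrightarrow> v \<lhd> w \<Longrightarrow> u \<lhd> w"
  by (auto simp: lexord_lex intro: lexord_trans)

lemma left_of_asym: "u \<lhd> v \<Longrightarrow> \<not> v \<lhd> u"
  using left_of_trans left_of_irrefl by blast

lemma left_of_total: "length u = length v \<Longrightarrow> u \<lhd> v \<or> u = v \<or> v \<lhd> u"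
  using total_lexord[OF total_less_than] unfolding total_on_def lexord_lex by auto

lemma left_of_append: "u \<lhd> v \<Longrightarrow> length u' = length v' \<Longrightarrow> u @ u' \<lhd> v @ v'"
  by (rule lex_append_rightI) simp_all

lemma finite_has_rightmost:
  assumes "finite S" "S \<noteq> {}" "\<And>u. u \<in> S \<Longrightarrow> length u = h"
  obtains v where "v \<in> S" "\<And>u. u \<in> S \<Longrightarrow> u \<noteq> v \<Longrightarrow> u \<lhd> v"
proof -
  have "\<exists>v\<in>S. \<forall>u\<in>S. u \<noteq> v \<longrightarrow> u \<lhd> v"
    using assms
  proof (induction rule: finite_ne_induct)
    case (insert x F)
    then obtain v where v: "v \<in> F" "\<forall>u\<in>F. u \<noteq> v \<longrightarrow> u \<lhd> v" by blast
    have "x \<lhd> v \<or> v \<lhd> x" using left_of_total[of x v] insert v by auto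
    then show ?case using v by (metis insert_iff left_of_trans)
  qed simp
  then show ?thesis using that by blast
qed

text \<open>Rightmost vertices are moved one by one from the left part to the right part until
  \<open>n\<close> vertices remain on the left. This is how a block of consecutive vertices is cut
  off a level.\<close>

lemma split_rightmost:
  assumes "finite S" "\<And>u. u \<in> S \<Longrightarrow> length u = h" "n \<le> card S"
  obtains S1 S2 where "S = S1 \<union> S2" "S1 \<inter> S2 = {}" "card S1 = n" "card S2 = card S - n"
    "\<And>u v. u \<in> S1 \<Longrightarrow> v \<in> S2 \<Longrightarrow> u \<lhd> v"
proof -
  have "\<exists>S1 S2. S = S1 \<union> S2 \<and> S1 \<inter> S2 = {} \<and> card S2 = m \<and> (\<forall>u\<in>S1. \<forall>v\<in>S2. u \<lhd> v)"
    if "m \<le> card S" for m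
    using that
  proof (induction m)
    case 0
    show ?case by (rule exI[of _ S], rule exI[of _ "{}"]) auto
  next
    case (Suc m)
    then obtain S1 S2 where s: "S = S1 \<union> S2" "S1 \<inter> S2 = {}" "card S2 = m"
      "\<forall>u\<in>S1. \<forall>v\<in>S2. u \<lhd> v" by auto
    have fin: "finite S1" "finite S2" using s assms(1) by auto
    have "S1 \<noteq> {}" using s Suc.prems by auto
    then obtain v where v: "v \<in> S1" "\<And>u. u \<in> S1 \<Longrightarrow> u \<noteq> v \<Longrightarrow> u \<lhd> v"
      using finite_has_rightmost[of S1 h] fin s assms(2) by (metis UnI1)
    have "v \<notin> S2" using s(2) v(1) by auto
    then have "card (insert v S2) = Suc m" using s(3) fin by simp
    then show ?case using s v
      by (intro exI[of _ "S1 - {v}"] exI[of _ "insert v S2"]) auto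
  qed
  from this[of "card S - n"] obtain S1 S2 where s: "S = S1 \<union> S2" "S1 \<inter> S2 = {}"
    "card S2 = card S - n" "\<forall>u\<in>S1. \<forall>v\<in>S2. u \<lhd> v" by auto
  have "card S = card S1 + card S2"
    unfolding s(1) using s(1,2) assms(1) by (intro card_Un_disjoint) auto
  then have "card S1 = n" using s assms by simp
  with s show ?thesis using that by blast
qed

section \<open>Potentials and the cost of crossing a strip\<close>

definition next_right :: "nat list set \<Rightarrow> nat list \<Rightarrow> nat list \<Rightarrow> bool" where
  "next_right X u v \<longleftrightarrow> u \<in> X \<and> v \<in> X \<and> u \<lhd> v \<and> \<not> (\<exists>w\<in>X. u \<lhd> w \<and> w \<lhd> v)"

text \<open>Edges are oriented upwards or to the right. The cyclic closing edge of a level is left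
  out on purpose, so that a strip has a left and a right end.\<close>

definition strip_edge :: "nat list set \<Rightarrow> nat \<Rightarrow> nat \<Rightarrow> nat list \<Rightarrow> nat list \<Rightarrow> bool" where
  "strip_edge X a b u v \<longleftrightarrow> u \<in> X \<and> v \<in> X \<and> length u \<in> {a..b} \<and> length v \<in> {a..b} \<and>
     ((\<exists>i. v = u @ [i]) \<or> next_right X u v)"

definition leftmost_in :: "nat list set \<Rightarrow> nat list \<Rightarrow> bool" where
  "leftmost_in X u \<longleftrightarrow> u \<in> X \<and> \<not> (\<exists>w\<in>X. w \<lhd> u)"

definition rightmost_in :: "nat list set \<Rightarrow> nat list \<Rightarrow> bool" where
  "rightmost_in X u \<longleftrightarrow> u \<in> X \<and> \<not> (\<exists>w\<in>X. u \<lhd> w)"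

text \<open>A potential certifies that every path in the strip from a leftmost to a rightmost vertex of
  \<open>X\<close> visits at least \<open>l\<close> vertices. Unlike paths, potentials of adjacent regions can simply be
  stacked on top of each other.\<close>

definition potential :: "nat list set \<Rightarrow> nat \<Rightarrow> nat \<Rightarrow> nat \<Rightarrow> (nat list \<Rightarrow> nat) \<Rightarrow> bool" where
  "potential X a b l \<phi> \<longleftrightarrow>
     (\<forall>u v. strip_edge X a b u v \<longrightarrow> \<phi> u \<le> \<phi> v + 1 \<and> \<phi> v \<le> \<phi> u + 1) \<and>
     (\<forall>u\<in>X. length u \<in> {a..b} \<longrightarrow> \<phi> u \<le> l) \<and>
     (\<forall>u. leftmost_in X u \<longrightarrow> length u \<in> {a..b} \<longrightarrow> \<phi> u \<le> 1) \<and>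
     (\<forall>u. rightmost_in X u \<longrightarrow> length u \<in> {a..b} \<longrightarrow> \<phi> u = l)"

text \<open>On an empty level the boundary conditions of a potential are vacuous and a path could
  slip past the strip there; hence the demand that every level be occupied. The disjunct
  \<open>l = 0\<close> lets a block that has died out count as a block of cost 0.\<close>

definition wide :: "nat list set \<Rightarrow> nat \<Rightarrow> nat \<Rightarrow> nat \<Rightarrow> bool" where
  "wide X a b l \<longleftrightarrow> l = 0 \<or>
     (\<forall>t\<in>{a..b}. \<exists>u\<in>X. length u = t) \<and> (\<exists>\<phi>. potential X a b l \<phi>)"

lemma wide_0: "wide X a b 0"
  by (simp add: wide_def)

lemma wide_1:
  assumes "\<forall>t\<in>{a..b}. \<exists>u\<in>X. length u = t"
  shows "wide X a b 1"
  unfolding wide_def potential_def using assms by (auto intro!: exI[of _ "\<lambda>_. 1"])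

text \<open>Everything in a potential is local to the heights \<open>a\<close> to \<open>b\<close>,
  because \<open>\<lhd>\<close> compares only words of equal length. Hence \<open>wide\<close> can
  be read off a truncation, and it does not see how the strip was grown.\<close>

lemma wide_cong:
  assumes "\<And>u. length u \<in> {a..b} \<Longrightarrow> u \<in> X \<longleftrightarrow> u \<in> Y"
  shows "wide X a b l \<longleftrightarrow> wide Y a b l"
proof -
  have *: "wide Y a b l" if XY: "\<And>u. length u \<in> {a..b} \<Longrightarrow> u \<in> X \<longleftrightarrow> u \<in> Y"
    and "wide X a b l" for X Y
  proof (cases "l = 0")
    case False
    with that obtain \<phi> where ne: "\<forall>t\<in>{a..b}. \<exists>u\<in>X. length u = t" and p: "potential X a b l \<phi>"
      by (auto simp: wide_def)
    have e: "strip_edge Y a b u v \<Longrightarrow> strip_edge X a b u v" for u v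
      unfolding strip_edge_def next_right_def using XY left_of_length by metis
    have l: "leftmost_in Y u \<Longrightarrow> length u \<in> {a..b} \<Longrightarrow> leftmost_in X u" for u
      unfolding leftmost_in_def using XY left_of_length by metis
    have r: "rightmost_in Y u \<Longrightarrow> length u \<in> {a..b} \<Longrightarrow> rightmost_in X u" for u
      unfolding rightmost_in_def using XY left_of_length by metis
    have "potential Y a b l \<phi>"
      using p e l r XY unfolding potential_def by blast
    moreover have "\<forall>t\<in>{a..b}. \<exists>u\<in>Y. length u = t" using ne XY by metis
    ultimately show ?thesis unfolding wide_def by blast
  qed (simp add: wide_0)
  show ?thesis using *[of X Y] *[of Y X] assms by blast
qed

text \<open>The potential of \<open>Y\<close> is raised by \<open>l1\<close> and placed to the right
  of that of \<open>X\<close>. An edge from \<open>X\<close> to \<open>Y\<close> joins a right end,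
  of value \<open>l1\<close>, to a left end, of value at most \<open>l1 + 1\<close>, so the
  Lipschitz condition survives.\<close>

lemma wide_Un:
  assumes w1: "wide X a b l1" and w2: "wide Y a b l2"
    and XY: "\<And>u v. u \<in> X \<Longrightarrow> v \<in> Y \<Longrightarrow> length u = length v \<Longrightarrow> u \<lhd> v"
    and XY': "\<And>u i. u \<in> X \<Longrightarrow> u @ [i] \<in> Y \<Longrightarrow> a \<le> length u \<Longrightarrow> False"
    and YX': "\<And>u i. u \<in> Y \<Longrightarrow> u @ [i] \<in> X \<Longrightarrow> a \<le> length u \<Longrightarrow> False"
  shows "wide (X \<union> Y) a b (l1 + l2)"
proof -
  have disj: "u \<in> X \<Longrightarrow> u \<notin> Y" for u using XY[of u u] left_of_irrefl by blast
  have edge: "(strip_edge X a b u v \<and> u \<in> X \<and> v \<in> X) \<or> (strip_edge Y a b u v \<and> u \<in> Y \<and> v \<in> Y) \<or>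
      (rightmost_in X u \<and> leftmost_in Y v \<and> u \<in> X \<and> v \<in> Y)"
    if "strip_edge (X \<union> Y) a b u v" for u v
  proof (cases "\<exists>i. v = u @ [i]")
    case True
    then show ?thesis using that XY' YX' unfolding strip_edge_def by auto
  next
    case False
    with that have n: "next_right (X \<union> Y) u v" unfolding strip_edge_def by blast
    then have len: "length u = length v" using left_of_length unfolding next_right_def by blast
    show ?thesis
    proof (cases "u \<in> X")
      case uX: True
      show ?thesis
      proof (cases "v \<in> X")
        case True
        then have "next_right X u v" using n uX unfolding next_right_def by blast
        then show ?thesis using that True uX unfolding strip_edge_def by blast
      next
        case False
        then have "v \<in> Y" using n unfolding next_right_def by blast
        moreover have "rightmost_in X u"
          unfolding rightmost_in_def
          using n uX XY[OF _ \<open>v \<in> Y\<close>] left_of_length len unfolding next_right_def by (metis UnI1)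
        moreover have "leftmost_in Y v"
          unfolding leftmost_in_def
          using n \<open>v \<in> Y\<close> XY[OF uX] left_of_length len unfolding next_right_def by (metis UnI2)
        ultimately show ?thesis using uX by blast
      qed
    next
      case False
      then have uY: "u \<in> Y" using n unfolding next_right_def by blast
      moreover have "v \<notin> X" using XY[of v u] uY len n left_of_asym unfolding next_right_def by metis
      ultimately have "v \<in> Y" "next_right Y u v" using n unfolding next_right_def by blast+
      then show ?thesis using that uY unfolding strip_edge_def by blast
    qed
  qed
  consider "l1 = 0" "l2 = 0" | "l1 = 0" "l2 \<noteq> 0" | "l1 \<noteq> 0" "l2 = 0" | "l1 \<noteq> 0" "l2 \<noteq> 0" by blast
  then show ?thesis
  proof cases
    case 1 then show ?thesis by (simp add: wide_0)
  next
    case 2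
    with w2 obtain \<phi> where ne: "\<forall>t\<in>{a..b}. \<exists>u\<in>Y. length u = t" and p: "potential Y a b l2 \<phi>"
      by (auto simp: wide_def)
    \<comment> \<open>With cost 0, \<open>X\<close> may have empty levels and no potential at all.
      The constant 0 on \<open>X\<close> is compatible with values at most 1 at the left end of
      \<open>Y\<close>.\<close>
    let ?f = "\<lambda>u. if u \<in> X then 0 else \<phi> u"
    have "?f u \<le> ?f v + 1 \<and> ?f v \<le> ?f u + 1" if "strip_edge (X \<union> Y) a b u v" for u v
      using edge[OF that] p disj that by (auto simp: potential_def strip_edge_def)
    moreover have "?f u = l2" if u: "rightmost_in (X \<union> Y) u" "length u \<in> {a..b}" for u
    proof -
      obtain y where "y \<in> Y" "length y = length u" using ne u(2) by metis
      then have "u \<notin> X" using XY that unfolding rightmost_in_def by (metis UnI2)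
      then have "rightmost_in Y u" using that(1) unfolding rightmost_in_def by blast
      then show ?thesis using p that \<open>u \<notin> X\<close> unfolding potential_def by auto
    qed
    moreover have "?f u \<le> 1" if u: "leftmost_in (X \<union> Y) u" "length u \<in> {a..b}" for u
      using that p unfolding potential_def leftmost_in_def by auto
    moreover have "?f u \<le> l2" if "u \<in> X \<union> Y" "length u \<in> {a..b}" for u
      using that p unfolding potential_def by auto
    ultimately have "potential (X \<union> Y) a b l2 ?f" unfolding potential_def by blast
    then show ?thesis using 2 ne unfolding wide_def by auto
  next
    case 3
    with w1 obtain \<phi> where ne: "\<forall>t\<in>{a..b}. \<exists>u\<in>X. length u = t" and p: "potential X a b l1 \<phi>"
      by (auto simp: wide_def)
    \<comment> \<open>Here \<open>Y\<close> carries no potential and receives the constant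
      \<open>l1\<close>, the value at the right end of \<open>X\<close>.\<close>
    let ?f = "\<lambda>u. if u \<in> X then \<phi> u else l1"
    have "?f u \<le> ?f v + 1 \<and> ?f v \<le> ?f u + 1" if "strip_edge (X \<union> Y) a b u v" for u v
      using edge[OF that] p disj that by (auto simp: potential_def strip_edge_def)
    moreover have "?f u \<le> 1" if u: "leftmost_in (X \<union> Y) u" "length u \<in> {a..b}" for u
    proof -
      obtain y where "y \<in> X" "length y = length u" using ne u(2) by metis
      then have "u \<notin> Y" using XY that unfolding leftmost_in_def by (metis UnI1)
      then have "leftmost_in X u" using that(1) unfolding leftmost_in_def by blast
      then show ?thesis using p that \<open>u \<notin> Y\<close> unfolding potential_def leftmost_in_def by auto
    qed
    moreover have "?f u = l1" if u: "rightmost_in (X \<union> Y) u" "length u \<in> {a..b}" for u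
      using that p unfolding potential_def rightmost_in_def by auto
    moreover have "?f u \<le> l1" if "u \<in> X \<union> Y" "length u \<in> {a..b}" for u
      using that p unfolding potential_def by auto
    ultimately have "potential (X \<union> Y) a b l1 ?f" unfolding potential_def by blast
    then show ?thesis using 3 ne unfolding wide_def by auto
  next
    case 4
    with w1 w2 obtain \<phi>1 \<phi>2 where ne: "\<forall>t\<in>{a..b}. \<exists>u\<in>X. length u = t" "\<forall>t\<in>{a..b}. \<exists>u\<in>Y. length u = t"
      and p: "potential X a b l1 \<phi>1" "potential Y a b l2 \<phi>2"
      by (auto simp: wide_def)
    let ?f = "\<lambda>u. if u \<in> X then \<phi>1 u else l1 + \<phi>2 u"
    have "?f u \<le> ?f v + 1 \<and> ?f v \<le> ?f u + 1" if e: "strip_edge (X \<union> Y) a b u v" for u v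
      using edge[OF e]
    proof (elim disjE)
      assume "rightmost_in X u \<and> leftmost_in Y v \<and> u \<in> X \<and> v \<in> Y"
      moreover from this have "\<phi>1 u = l1" "\<phi>2 v \<le> 1" using p e unfolding potential_def strip_edge_def by blast+
      ultimately show ?thesis using disj by auto
    qed (use p disj in \<open>auto simp: potential_def\<close>)
    moreover have "?f u \<le> 1" if u: "leftmost_in (X \<union> Y) u" "length u \<in> {a..b}" for u
    proof -
      obtain y where "y \<in> X" "length y = length u" using ne u(2) by metis
      then have "u \<notin> Y" using XY that unfolding leftmost_in_def by (metis UnI1)
      then have "leftmost_in X u" using that(1) unfolding leftmost_in_def by blast
      then show ?thesis using p that \<open>u \<notin> Y\<close> unfolding potential_def leftmost_in_def by auto
    qed
    moreover have "?f u = l1 + l2" if u: "rightmost_in (X \<union> Y) u" "length u \<in> {a..b}" for u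
    proof -
      obtain y where "y \<in> Y" "length y = length u" using ne u(2) by metis
      then have "u \<notin> X" using XY that unfolding rightmost_in_def by (metis UnI2)
      then have "rightmost_in Y u" using that(1) unfolding rightmost_in_def by blast
      then show ?thesis using p that \<open>u \<notin> X\<close> unfolding potential_def by auto
    qed
    moreover have "?f u \<le> l1 + l2" if "u \<in> X \<union> Y" "length u \<in> {a..b}" for u
      using that p unfolding potential_def by (auto simp: trans_le_add1)
    ultimately have "potential (X \<union> Y) a b (l1 + l2) ?f" unfolding potential_def by blast
    then show ?thesis using 4 ne unfolding wide_def by auto
  qed
qed

section \<open>Paths in a strip and overlapping layers\<close>

definition strip_graph :: "nat list set \<Rightarrow> nat \<Rightarrow> nat \<Rightarrow> (nat list \<times> nat list) set" where
  "strip_graph X a b = {(u, v). strip_edge X a b u v \<or> strip_edge X a b v u}"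

lemma strip_edge_length:
  "strip_edge X a b u v \<Longrightarrow> length u \<le> length v \<and> length v \<le> Suc (length u)"
  unfolding strip_edge_def next_right_def using left_of_length by fastforce

lemma potential_path:
  assumes "potential X a b l \<phi>" "(u, v) \<in> strip_graph X a b ^^ n"
  shows "\<phi> v \<le> \<phi> u + n"
  using assms(2)
proof (induction n arbitrary: v)
  case (Suc n)
  then obtain w where "(u, w) \<in> strip_graph X a b ^^ n" "(w, v) \<in> strip_graph X a b" by auto
  with Suc.IH assms(1) show ?case unfolding strip_graph_def potential_def by fastforce
qed simp

text \<open>Each step changes the height by at most 1. The second alternative in each assumption
  covers windows that reach the boundary of the strip, where the path is confined anyway.\<close>

lemma strip_path_window:
  assumes "(u, v) \<in> strip_graph X a b ^^ n" "a' \<le> length u - n \<or> a' \<le> a" "length u + n \<le> b' \<or> b \<le> b'"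
    and "u \<in> X \<and> length u \<in> {a..b}"
  shows "(u, v) \<in> strip_graph X a' b' ^^ n"
proof -
  have "(u, v) \<in> strip_graph X a' b' ^^ k \<and> length u \<le> length v + k \<and> length v \<le> length u + k
      \<and> v \<in> X \<and> length v \<in> {a..b}"
    if "(u, v) \<in> strip_graph X a b ^^ k" "k \<le> n" for k v
    using that
  proof (induction k arbitrary: v)
    case (Suc k)
    then obtain w where w: "(u, w) \<in> strip_graph X a b ^^ k" "(w, v) \<in> strip_graph X a b" by auto
    note IH = Suc.IH[OF w(1)]
    have len: "length w \<le> Suc (length v)" "length v \<le> Suc (length w)"
      using w(2) strip_edge_length unfolding strip_graph_def by fastforce+
    have r: "length v \<in> {a..b}" "v \<in> X" using w(2) unfolding strip_graph_def strip_edge_def by auto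
    have "length v \<in> {a'..b'}" "length w \<in> {a'..b'}"
      using IH Suc.prems len r assms(2,3) by auto
    then have "(w, v) \<in> strip_graph X a' b'"
      using w(2) unfolding strip_graph_def strip_edge_def by auto
    then show ?case using IH Suc.prems len r by auto
  qed (use assms in auto)
  then show ?thesis using assms(1) by blast
qed

text \<open>Layers of height \<open>2 * H\<close> are placed at offsets \<open>H\<close>, so a path
  with fewer than \<open>l\<close> steps, where \<open>l\<close> is at most \<open>H / 2\<close>,
  lies in one of them. The potential of the tall strip is the distance from its left end, counted in
  vertices and capped at \<open>l\<close>; the cap is reached on the right end because a shorter
  path would contradict the potential of its layer.\<close>

lemma wide_layers:
  assumes fin: "\<And>t. finite {u\<in>X. length u = t}"
    and m: "2 \<le> m" and lH: "2 * l \<le> H"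
    and lay: "\<And>k. k \<le> m - 2 \<Longrightarrow> wide X (a + k * H) (a + (k + 2) * H) l"
  shows "wide X a (a + m * H) l"
proof (cases "l = 0")
  case False
  let ?b = "a + m * H"
  have H: "H > 0" using False lH by linarith
  \<comment> \<open>The window of radius \<open>l\<close> around \<open>t\<close> has height at most
    \<open>H\<close>. Rounding its lower end down to a multiple of \<open>H\<close> above
    \<open>a\<close> gives a layer that contains it.\<close>
  have layer: "\<exists>k\<le>m - 2. a + k * H \<le> max a (t - l) \<and> min ?b (t + l) \<le> a + (k + 2) * H"
    if "t \<in> {a..?b}" for t
  proof (cases "(t - l - a) div H \<le> m - 2")
    case True
    let ?k = "(t - l - a) div H"
    have "?k * H \<le> t - l - a" by simp
    moreover have "t - l - a < ?k * H + H" using H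
      by (metis add.commute dividend_less_times_div mult.commute)
    moreover have "(?k + 2) * H = ?k * H + H + H" by (simp add: algebra_simps)
    ultimately have "a + ?k * H \<le> max a (t - l) \<and> min ?b (t + l) \<le> a + (?k + 2) * H"
      using lH by linarith
    with True show ?thesis by blast
  next
    \<comment> \<open>Near the top of the strip the rounded index is too large; the last layer, with
      index \<open>m - 2\<close>, then ends exactly at the top.\<close>
    case F: False
    then have "m - 2 < (t - l - a) div H" by simp
    then have "(m - 2) * H \<le> t - l - a"
      using H by (metis less_eq_div_iff_mult_less_eq less_or_eq_imp_le)
    then have "a + (m - 2) * H \<le> max a (t - l)" by linarith
    moreover have "m - 2 + 2 = m" using m by simp
    ultimately show ?thesis by (intro exI[of _ "m - 2"]) simp
  qed
  \<comment> \<open>A path with \<open>n\<close> edges visits \<open>Suc n\<close> vertices. The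
    inserted \<open>l\<close> caps the distance and keeps the set nonempty, so that its infimum is
    attained.\<close>
  define D where "D v = insert l {Suc n | n. \<exists>u. leftmost_in X u \<and> length u \<in> {a..?b} \<and>
    (u, v) \<in> strip_graph X a ?b ^^ n}" for v
  define \<phi> where "\<phi> v = Inf (D v)" for v
  have D: "\<phi> v \<in> D v" for v unfolding \<phi>_def by (rule Inf_nat_def1) (simp add: D_def)
  have Dle: "n \<in> D v \<Longrightarrow> \<phi> v \<le> n" for v n unfolding \<phi>_def by (rule cInf_lower) auto
  have step: "\<phi> v \<le> \<phi> u + 1" if "(u, v) \<in> strip_graph X a ?b" for u v
  proof (cases "\<phi> u = l")
    case True
    then show ?thesis using Dle[of l v] by (simp add: D_def)
  next
    case False
    with D[of u] obtain n w where n: "\<phi> u = Suc n" "leftmost_in X w" "length w \<in> {a..?b}"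
      "(w, u) \<in> strip_graph X a ?b ^^ n" unfolding D_def by blast
    then have "(w, v) \<in> strip_graph X a ?b ^^ Suc n" using that by auto
    then have "Suc (Suc n) \<in> D v" using n unfolding D_def by blast
    then show ?thesis using Dle n by fastforce
  qed
  have lm: "\<phi> u \<le> 1" if "leftmost_in X u" "length u \<in> {a..?b}" for u
  proof (rule Dle)
    have "(u, u) \<in> strip_graph X a ?b ^^ 0" by simp
    then show "1 \<in> D u" using that unfolding D_def One_nat_def by blast
  qed
  have rm: "\<phi> v = l" if "rightmost_in X v" "length v \<in> {a..?b}" for v
  proof (rule ccontr)
    assume "\<phi> v \<noteq> l"
    with D[of v] Dle[of l v] obtain n u where n: "\<phi> v = Suc n" "Suc n < l" "leftmost_in X u"
      "length u \<in> {a..?b}" "(u, v) \<in> strip_graph X a ?b ^^ n"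
      unfolding D_def by force
    \<comment> \<open>The short path from \<open>u\<close> stays in one layer. There the layer
      potential would have to climb from at most 1 to \<open>l\<close> in \<open>n\<close> steps,
      although \<open>Suc n < l\<close>.\<close>
    obtain k where k: "k \<le> m - 2" "a + k * H \<le> max a (length u - l)"
      "min ?b (length u + l) \<le> a + (k + 2) * H" using layer[OF n(4)] by blast
    let ?a' = "a + k * H" and ?b' = "a + (k + 2) * H"
    have path: "(u, v) \<in> strip_graph X ?a' ?b' ^^ n"
    proof (rule strip_path_window[OF n(5)])
      show "?a' \<le> length u - n \<or> ?a' \<le> a" using k(2) n(2) by linarith
      show "length u + n \<le> ?b' \<or> ?b \<le> ?b'" using k(3) n(2) by linarith
      show "u \<in> X \<and> length u \<in> {a..?b}" using n by (auto simp: leftmost_in_def)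
    qed
    obtain \<psi> where p: "potential X ?a' ?b' l \<psi>"
      using lay[OF k(1)] False by (auto simp: wide_def)
    have lu: "length u \<in> {?a'..?b'}"
      using k n(4) by auto
    have lv: "length v \<in> {?a'..?b'}"
    proof (cases n)
      case 0
      then show ?thesis using path lu by simp
    next
      case (Suc n')
      then show ?thesis using path unfolding Suc by (auto simp: strip_graph_def strip_edge_def)
    qed
    have "\<psi> v = l" "\<psi> u \<le> 1" using p that(1) lu lv n(3) unfolding potential_def by blast+
    then show False using potential_path[OF p path] n by simp
  qed
  have "potential X a ?b l \<phi>"
    unfolding potential_def using step lm rm Dle[of l]
    by (auto simp: strip_graph_def D_def)
  moreover have "\<exists>u\<in>X. length u = t" if t: "t \<in> {a..?b}" for t
  proof -
    obtain k where "k \<le> m - 2" "a + k * H \<le> max a (t - l)" "min ?b (t + l) \<le> a + (k + 2) * H"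
      using layer[OF t] by blast
    moreover from this have "t \<in> {a + k * H..a + (k + 2) * H}" using t by auto
    ultimately show ?thesis using lay[of k] False unfolding wide_def by blast
  qed
  ultimately show ?thesis unfolding wide_def by blast
qed (simp add: wide_0)

section \<open>From two wide halves of a level to the girth\<close>

definition descendants :: "nat list set \<Rightarrow> nat list set \<Rightarrow> nat \<Rightarrow> nat list set" where
  "descendants \<tau> S h = {u \<in> \<tau>. h \<le> length u \<and> take h u \<in> S}"

text \<open>Two interfaces separate the halves on the cyclic level: the right end of
  \<open>S1\<close> meets the left end of \<open>S2\<close>, and the right end of \<open>S2\<close>
  meets the left end of \<open>S1\<close>. A path from one interface to the other crosses one half
  completely, which costs about \<open>l\<close>, or leaves the strip, which takes more than
  \<open>H\<close> steps from the middle level.\<close>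

lemma girth_ge_of_wide:
  assumes tr: "plane_tree \<tau>" "locally_finite \<tau>"
    and S: "level h \<tau> = S1 \<union> S2" "\<And>u v. u \<in> S1 \<Longrightarrow> v \<in> S2 \<Longrightarrow> u \<lhd> v"
    and w: "wide (descendants \<tau> S1 h) h (h + 2 * H) l" "wide (descendants \<tau> S2 h) h (h + 2 * H) l"
  shows "min l H \<le> girth (h + H) \<tau>"
proof (cases "l = 0 \<or> H = 0")
  case False
  let ?X = "descendants \<tau> S1 h" and ?Y = "descendants \<tau> S2 h" and ?b = "h + 2 * H"
  let ?r = "h + H"
  obtain \<phi>1 \<phi>2 where ne: "\<forall>t\<in>{h..?b}. \<exists>u\<in>?X. length u = t" "\<forall>t\<in>{h..?b}. \<exists>u\<in>?Y. length u = t"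
    and p: "potential ?X h ?b l \<phi>1" "potential ?Y h ?b l \<phi>2"
    using w False by (auto simp: wide_def)
  have pre: "take h u \<in> \<tau>" if "u \<in> \<tau>" for u h
  proof (cases "h \<le> length u")
    case True
    have "take (length u - k) u \<in> \<tau>" if "k \<le> length u" for k
      using that
    proof (induction k)
      case (Suc k)
      have "take (length u - k) u = take (length u - Suc k) u @ [u ! (length u - Suc k)]"
        using Suc.prems by (metis Suc_diff_Suc Suc_le_lessD diff_less take_Suc_conv_app_nth
            zero_less_Suc length_greater_0_conv less_zeroE list.size(3))
      then show ?case using Suc plane_tree_parent[OF tr(1)] by simp
    qed (use \<open>u \<in> \<tau>\<close> in simp)
    from this[of "length u - h"] True show ?thesis by simp
  qed (use that in simp)
  have XY: "u \<in> ?X \<or> u \<in> ?Y" if "u \<in> \<tau>" "h \<le> length u" for u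
  proof -
    have "take h u \<in> level h \<tau>" using pre[OF that(1)] that(2) by (simp add: level_def)
    then show ?thesis using that S(1) by (auto simp: descendants_def)
  qed
  have ord: "u \<lhd> v" if "u \<in> ?X" "v \<in> ?Y" "length u = length v" for u v
  proof -
    have "take h u \<lhd> take h v" using that S(2) by (auto simp: descendants_def)
    then have "take h u @ drop h u \<lhd> take h v @ drop h v"
      using that by (intro left_of_append) auto
    then show ?thesis by simp
  qed
  then have disj: "u \<in> ?X \<Longrightarrow> u \<notin> ?Y" for u using left_of_irrefl by blast
  have sub: "?X \<subseteq> \<tau>" "?Y \<subseteq> \<tau>" by (auto simp: descendants_def)
  \<comment> \<open>Along the cyclic order this function climbs to \<open>l\<close> across the first
    half and falls back to 0 across the second, so it is Lipschitz through both interfaces.\<close>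
  define \<psi> where "\<psi> u = (if u \<in> ?X then \<phi>1 u else l - \<phi>2 u)" for u
  have edge: "\<psi> u \<le> \<psi> v + 1 \<and> \<psi> v \<le> \<psi> u + 1"
    if uv: "u \<in> \<tau>" "v \<in> \<tau>" "length u \<in> {h..?b}" "length v \<in> {h..?b}"
      and e: "(\<exists>i. v = u @ [i]) \<or> next_in_level \<tau> u v" for u v
  proof (cases "(\<exists>i. v = u @ [i]) \<or> next_right \<tau> u v")
    case vert: True
    consider "u \<in> ?X" "v \<in> ?X" | "u \<in> ?Y" "v \<in> ?Y" | "u \<in> ?X" "v \<in> ?Y" | "u \<in> ?Y" "v \<in> ?X"
      using XY uv by auto
    then show ?thesis
    proof cases
      case 1
      then have "strip_edge ?X h ?b u v" using vert uv sub unfolding strip_edge_def next_right_def by blast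
      then show ?thesis using p(1) 1 unfolding potential_def \<psi>_def by auto
    next
      case 2
      then have "strip_edge ?Y h ?b u v" using vert uv sub unfolding strip_edge_def next_right_def by blast
      then have "\<phi>2 u \<le> \<phi>2 v + 1 \<and> \<phi>2 v \<le> \<phi>2 u + 1" using p(2) unfolding potential_def by blast
      then show ?thesis using 2 disj unfolding \<psi>_def by auto
    next
      case 3
      have "\<not> (\<exists>i. v = u @ [i])"
        using 3 uv S(2) left_of_irrefl by (force simp: descendants_def)
      then have n: "next_right \<tau> u v" using vert by blast
      then have len: "length u = length v" using left_of_length unfolding next_right_def by blast
      have "rightmost_in ?X u"
        unfolding rightmost_in_def
        using n 3 ord[OF _ 3(2)] left_of_length len sub unfolding next_right_def by (metis subsetD)
      moreover have "leftmost_in ?Y v"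
        unfolding leftmost_in_def
        using n 3 ord[OF 3(1)] left_of_length len sub unfolding next_right_def by (metis subsetD)
      ultimately have "\<phi>1 u = l" "\<phi>2 v \<le> 1" using p uv unfolding potential_def by blast+
      then show ?thesis using 3 disj unfolding \<psi>_def by auto
    next
      case 4
      have "\<not> (\<exists>i. v = u @ [i])"
        using 4 uv S(2) left_of_irrefl by (force simp: descendants_def)
      then have n: "next_right \<tau> u v" using vert by blast
      then show ?thesis using ord[OF 4(2,1)] left_of_length left_of_asym unfolding next_right_def by metis
    qed
  next
    \<comment> \<open>This is the cyclic closing edge, from the right end of the second half to the
      left end of the first. The values there are 0 and at most 1.\<close>
    case F: False
    with e have n: "\<not> (\<exists>w\<in>\<tau>. u \<lhd> w)" "\<not> (\<exists>w\<in>\<tau>. w \<lhd> v)" "length u = length v"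
      unfolding next_in_level_def next_right_def by auto
    obtain y where "y \<in> ?Y" "length y = length u" using ne(2) uv by metis
    then have uY: "u \<in> ?Y" using XY[of u] uv ord n sub by (metis atLeastAtMost_iff subsetD)
    obtain x where "x \<in> ?X" "length x = length v" using ne(1) uv by metis
    then have vX: "v \<in> ?X" using XY[of v] uv ord n sub by (metis atLeastAtMost_iff subsetD)
    have "rightmost_in ?Y u" "leftmost_in ?X v" using uY vX n sub
      unfolding rightmost_in_def leftmost_in_def by blast+
    then have "\<phi>2 u = l" "\<phi>1 v \<le> 1" using p uv unfolding potential_def by blast+
    then show ?thesis using uY vX disj unfolding \<psi>_def by auto
  qed
  have fin: "finite {u \<in> Z. length u = ?r}" if "Z \<subseteq> \<tau>" for Z
    by (rule finite_subset[OF _ finite_level[OF tr, of ?r]]) (use that in \<open>auto simp: level_def\<close>)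
  have ex: "\<exists>v. rightmost_in Z v \<and> length v = ?r" if Z: "Z \<subseteq> \<tau>" "\<forall>t\<in>{h..?b}. \<exists>u\<in>Z. length u = t" for Z
  proof -
    have "{u \<in> Z. length u = ?r} \<noteq> {}" using that(2) by auto
    then obtain v where v: "v \<in> {u \<in> Z. length u = ?r}"
      "\<And>u. u \<in> {u \<in> Z. length u = ?r} \<Longrightarrow> u \<noteq> v \<Longrightarrow> u \<lhd> v"
      using finite_has_rightmost[of "{u \<in> Z. length u = ?r}" ?r] fin[OF Z(1)] by blast
    then have "rightmost_in Z v" unfolding rightmost_in_def
      using left_of_length left_of_asym left_of_irrefl by (metis (mono_tags, lifting) mem_Collect_eq)
    then show ?thesis using v by blast
  qed
  \<comment> \<open>The two witnesses for the girth lie on the middle level \<open>h + H\<close>, at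
    the right ends of the two halves, where \<open>\<psi>\<close> takes its extreme values
    \<open>l\<close> and 0.\<close>
  obtain y where y: "rightmost_in ?X y" "length y = ?r" using ex[OF sub(1) ne(1)] by blast
  obtain x where x: "rightmost_in ?Y x" "length x = ?r" using ex[OF sub(2) ne(2)] by blast
  have xy: "x \<in> ?Y" "y \<in> ?X" "x \<in> \<tau>" "y \<in> \<tau>" using x y sub unfolding rightmost_in_def by blast+
  have "\<psi> y = l" "\<psi> x = 0"
    using p x y disj xy unfolding potential_def \<psi>_def by auto
  \<comment> \<open>At most \<open>H\<close> steps from the middle level do not leave the strip, so
    each step changes \<open>\<psi>\<close> by at most 1.\<close>
  have path: "\<psi> v \<le> \<psi> x + n \<and> length v \<le> ?r + n \<and> ?r \<le> length v + n"
    if "(x, v) \<in> causal \<tau> ^^ n" "n \<le> H" for v n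
    using that
  proof (induction n arbitrary: v)
    case (Suc n)
    then obtain u where u: "(x, u) \<in> causal \<tau> ^^ n" "(u, v) \<in> causal \<tau>" by auto
    have IH: "\<psi> u \<le> \<psi> x + n" "length u \<le> ?r + n" "?r \<le> length u + n" using Suc u by auto
    have adj: "(u \<in> \<tau> \<and> v \<in> \<tau> \<and> ((\<exists>i. v = u @ [i]) \<or> next_in_level \<tau> u v)) \<or>
         (u \<in> \<tau> \<and> v \<in> \<tau> \<and> ((\<exists>i. u = v @ [i]) \<or> next_in_level \<tau> v u))"
      using u(2) plane_tree_parent[OF tr(1)] unfolding causal_def Let_def next_in_level_def by blast
    have len: "length v \<le> Suc (length u)" "length u \<le> Suc (length v)"
      using adj by (auto simp: next_in_level_def)
    then have r: "length u \<in> {h..?b}" "length v \<in> {h..?b}" using IH Suc.prems by auto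
    have "\<psi> v \<le> \<psi> u + 1" using adj edge r by blast
    then show ?case using IH len Suc.prems by auto
  qed (use x in auto)
  have "min l H \<le> graph_dist (causal \<tau>) x y"
  proof (rule ccontr)
    assume c: "\<not> min l H \<le> graph_dist (causal \<tau>) x y"
    have "(x, y) \<in> causal \<tau> ^^ graph_dist (causal \<tau>) x y"
      using graph_dist_causal_attained[OF tr(1) xy(3,4)] .
    moreover have "graph_dist (causal \<tau>) x y \<le> H" "graph_dist (causal \<tau>) x y < l"
      using c by (auto simp: min_def split: if_splits)
    ultimately show False using path[of y "graph_dist (causal \<tau>) x y"] \<open>\<psi> y = l\<close> \<open>\<psi> x = 0\<close> by auto
  qed
  also have "\<dots> \<le> girth ?r \<tau>"
    unfolding girth_def
  proof (rule cSup_upper)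
    show "graph_dist (causal \<tau>) x y \<in> {graph_dist (causal \<tau>) x y |x y. x \<in> level ?r \<tau> \<and> y \<in> level ?r \<tau>}"
      using x y xy by (auto simp: level_def)
    have "{graph_dist (causal \<tau>) x y |x y. x \<in> level ?r \<tau> \<and> y \<in> level ?r \<tau>}
      = (\<lambda>(x, y). graph_dist (causal \<tau>) x y) ` (level ?r \<tau> \<times> level ?r \<tau>)" by auto
    then show "bdd_above {graph_dist (causal \<tau>) x y |x y. x \<in> level ?r \<tau> \<and> y \<in> level ?r \<tau>}"
      using finite_level[OF tr] by simp
  qed
  finally show ?thesis .
qed auto

section \<open>Independent offspring numbers and branching\<close>

abbreviation offspring_field :: "nat pmf \<Rightarrow> (nat list \<Rightarrow> nat) measure" where
  "offspring_field \<mu> \<equiv> (\<Pi>\<^sub>M u\<in>UNIV. measure_pmf \<mu>)"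

interpretation offspring_field: product_prob_space "\<lambda>_::nat list. measure_pmf \<mu>" UNIV for \<mu> :: "nat pmf"
  by (intro product_prob_spaceI prob_space_measure_pmf)

lemma space_offspring_field [simp]: "space (offspring_field \<mu>) = UNIV"
  by (simp add: space_PiM)

lemma measurable_offspring [measurable]:
  "(\<lambda>K. K u) \<in> offspring_field \<mu> \<rightarrow>\<^sub>M count_space UNIV"
  using measurable_component_singleton[of u UNIV "\<lambda>_. measure_pmf \<mu>"]
  by (simp add: measurable_pmf_measure2)

lemma emeasure_offspring_field_space [simp]: "emeasure (offspring_field \<mu>) UNIV = 1"
  using offspring_field.P.emeasure_space_1[of \<mu>] by simp

lemma nn_integral_offspring:
  "(\<integral>\<^sup>+ K. f (K u) \<partial>offspring_field \<mu>) = (\<integral>\<^sup>+ k. f k \<partial>measure_pmf \<mu>)"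
proof -
  have "(\<integral>\<^sup>+ k. f k \<partial>measure_pmf \<mu>) = (\<integral>\<^sup>+ k. f k \<partial>distr (offspring_field \<mu>) (measure_pmf \<mu>) (\<lambda>K. K u))"
    using offspring_field.PiM_component[of u \<mu>] by simp
  also have "\<dots> = (\<integral>\<^sup>+ K. f (K u) \<partial>offspring_field \<mu>)"
    by (rule nn_integral_distr) auto
  finally show ?thesis ..
qed

definition overwrite :: "nat list set \<Rightarrow> (nat list \<Rightarrow> nat) \<Rightarrow> (nat list \<Rightarrow> nat) \<Rightarrow> nat list \<Rightarrow> nat" where
  "overwrite J K' K = (\<lambda>u. if u \<in> J then K' u else K u)"

lemma measurable_overwrite [measurable]:
  "(\<lambda>p. overwrite J (fst p) (snd p)) \<in>
     offspring_field \<mu> \<Otimes>\<^sub>M offspring_field \<mu> \<rightarrow>\<^sub>M offspring_field \<mu>"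
proof (rule measurable_PiM_single')
  fix u :: "nat list"
  show "(\<lambda>p. overwrite J (fst p) (snd p) u) \<in> offspring_field \<mu> \<Otimes>\<^sub>M offspring_field \<mu> \<rightarrow>\<^sub>M measure_pmf \<mu>"
    by (cases "u \<in> J")
      (auto simp: overwrite_def intro!: measurable_compose[OF measurable_fst measurable_component_singleton]
        measurable_compose[OF measurable_snd measurable_component_singleton])
qed auto

text \<open>On a cylinder over a finite \<open>I\<close>, the conditions split into those on
  \<open>I \<inter> J\<close>, seen by the first field, and those on \<open>I - J\<close>, seen by
  the second. Independence and the branching property are both drawn from this invariance.\<close>

lemma distr_overwrite:
  "distr (offspring_field \<mu> \<Otimes>\<^sub>M offspring_field \<mu>) (offspring_field \<mu>)
     (\<lambda>p. overwrite J (fst p) (snd p)) = offspring_field \<mu>"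
proof (rule offspring_field.PiM_eq)
  fix I :: "nat list set" and F :: "nat list \<Rightarrow> nat set"
  assume I: "finite I"
  let ?Q = "offspring_field \<mu>"
  let ?E = "\<lambda>I. prod_emb UNIV (\<lambda>_. measure_pmf \<mu>) I (Pi\<^sub>E I F)"
  have E: "?E I' = {K. \<forall>u\<in>I'. K u \<in> F u}" for I' :: "nat list set"
    by (auto simp: prod_emb_def)
  have [measurable]: "?E I' \<in> sets ?Q" if "finite I'" for I'
    using that by (intro sets_PiM_I) auto
  have eq: "(\<lambda>p. overwrite J (fst p) (snd p)) -` ?E I \<inter> space (?Q \<Otimes>\<^sub>M ?Q) = ?E (I \<inter> J) \<times> ?E (I - J)"
    by (auto simp: E overwrite_def space_pair_measure split: if_splits)
  have "emeasure (distr (?Q \<Otimes>\<^sub>M ?Q) ?Q (\<lambda>p. overwrite J (fst p) (snd p))) (?E I)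
      = emeasure (?Q \<Otimes>\<^sub>M ?Q) (?E (I \<inter> J) \<times> ?E (I - J))"
    using I by (subst emeasure_distr) (simp_all add: eq[simplified])
  also have "\<dots> = emeasure ?Q (?E (I \<inter> J)) * emeasure ?Q (?E (I - J))"
    using I by (intro offspring_field.P.emeasure_pair_measure_Times) auto
  also have "\<dots> = (\<Prod>u\<in>I \<inter> J. emeasure \<mu> (F u)) * (\<Prod>u\<in>I - J. emeasure \<mu> (F u))"
    using I by (simp add: offspring_field.emeasure_PiM_emb)
  also have "\<dots> = (\<Prod>u\<in>I. emeasure \<mu> (F u))"
    using I by (metis prod.Int_Diff)
  finally show "emeasure (distr (?Q \<Otimes>\<^sub>M ?Q) ?Q (\<lambda>p. overwrite J (fst p) (snd p))) (?E I)
      = (\<Prod>u\<in>I. emeasure \<mu> (F u))" .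
qed simp

lemma nn_integral_overwrite:
  assumes [measurable]: "\<Psi> \<in> borel_measurable (offspring_field \<mu>)"
  shows "(\<integral>\<^sup>+ K. \<Psi> K \<partial>offspring_field \<mu>) =
    (\<integral>\<^sup>+ K'. \<integral>\<^sup>+ K. \<Psi> (overwrite J K' K) \<partial>offspring_field \<mu> \<partial>offspring_field \<mu>)"
proof -
  let ?Q = "offspring_field \<mu>"
  have "(\<integral>\<^sup>+ K. \<Psi> K \<partial>?Q) = (\<integral>\<^sup>+ K. \<Psi> K \<partial>distr (?Q \<Otimes>\<^sub>M ?Q) ?Q (\<lambda>p. overwrite J (fst p) (snd p)))"
    by (simp add: distr_overwrite)
  also have "\<dots> = (\<integral>\<^sup>+ p. \<Psi> (overwrite J (fst p) (snd p)) \<partial>(?Q \<Otimes>\<^sub>M ?Q))"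
    by (rule nn_integral_distr) auto
  also have "\<dots> = (\<integral>\<^sup>+ K'. \<integral>\<^sup>+ K. \<Psi> (overwrite J K' K) \<partial>?Q \<partial>?Q)"
    by (subst offspring_field.P.nn_integral_fst[symmetric]) auto
  finally show ?thesis .
qed

text \<open>A pointwise stand-in for measurability with respect to the coordinates in
  \<open>J\<close>; independence can then be stated without sub-\<sigma>-algebras.\<close>

definition determined_by :: "((nat list \<Rightarrow> nat) \<Rightarrow> 'b) \<Rightarrow> nat list set \<Rightarrow> bool" where
  "determined_by g J \<longleftrightarrow> (\<forall>K K'. (\<forall>u\<in>J. K u = K' u) \<longrightarrow> g K = g K')"

lemma determined_byD: "determined_by g J \<Longrightarrow> (\<And>u. u \<in> J \<Longrightarrow> K u = K' u) \<Longrightarrow> g K = g K'"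
  by (auto simp: determined_by_def)

text \<open>After resampling the coordinates in \<open>I\<close>, the factor \<open>f\<close> sees
  only the first field and \<open>g\<close> only the second, and the double integral
  factors.\<close>

lemma nn_integral_indep:
  assumes [measurable]: "f \<in> borel_measurable (offspring_field \<mu>)" "g \<in> borel_measurable (offspring_field \<mu>)"
    and f: "determined_by f I" and g: "determined_by g J" and IJ: "I \<inter> J = {}"
  shows "(\<integral>\<^sup>+ K. f K * g K \<partial>offspring_field \<mu>) =
    (\<integral>\<^sup>+ K. f K \<partial>offspring_field \<mu>) * (\<integral>\<^sup>+ K. g K \<partial>offspring_field \<mu>)"
proof -
  have "f (overwrite I K' K) = f K'" "g (overwrite I K' K) = g K" for K' K
    using IJ by (auto simp: overwrite_def intro!: determined_byD[OF f] determined_byD[OF g])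
  then show ?thesis
    by (subst nn_integral_overwrite[where J = I]) (simp_all add: nn_integral_cmult nn_integral_multc)
qed

section \<open>Forests over a level and the branching property\<close>

text \<open>The part of the tree coded by \<open>K\<close> that lies above the words of \<open>S\<close>, which have length \<open>h\<close>.\<close>

definition forest :: "nat \<Rightarrow> nat list set \<Rightarrow> (nat list \<Rightarrow> nat) \<Rightarrow> nat list set" where
  "forest h S K = {u. h \<le> length u \<and> take h u \<in> S \<and> (\<forall>i\<in>{h..<length u}. u ! i < K (take i u))}"

definition base :: "nat \<Rightarrow> nat list set \<Rightarrow> bool" where
  "base h S \<longleftrightarrow> finite S \<and> (\<forall>u\<in>S. length u = h)"

lemma offspring_tree_eq_forest: "offspring_tree K = forest 0 {[]} K"
  by (auto simp: offspring_tree_def forest_def)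

lemma base_root: "base 0 {[]}"
  by (simp add: base_def)

lemma forest_Un: "forest h (S1 \<union> S2) K = forest h S1 K \<union> forest h S2 K"
  by (auto simp: forest_def)

lemma forest_snoc:
  assumes "h \<le> length u"
  shows "u @ [i] \<in> forest h S K \<longleftrightarrow> u \<in> forest h S K \<and> i < K u"
proof -
  have "{h..<length (u @ [i])} = insert (length u) {h..<length u}" using assms by auto
  then show ?thesis using assms by (auto simp: forest_def nth_append)
qed

lemma level_forest_base: "base h S \<Longrightarrow> level h (forest h S K) = S"
  by (auto simp: level_def forest_def base_def)

lemma level_forest_Suc:
  assumes "h \<le> t"
  shows "level (Suc t) (forest h S K) = (\<Union>u\<in>level t (forest h S K). (\<lambda>i. u @ [i]) ` {..<K u})"
proof safe
  fix w assume w: "w \<in> level (Suc t) (forest h S K)"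
  then obtain u i where ui: "w = u @ [i]" by (cases w rule: rev_cases) (auto simp: level_def)
  then have "length u = t" "u @ [i] \<in> forest h S K" using w by (simp_all add: level_def)
  then have "u \<in> level t (forest h S K)" "i < K u"
    using assms by (simp_all add: level_def forest_snoc)
  then show "w \<in> (\<Union>u\<in>level t (forest h S K). (\<lambda>i. u @ [i]) ` {..<K u})" using ui by auto
qed (use assms in \<open>auto simp: level_def forest_snoc\<close>)

lemma base_level_forest:
  assumes "base h S" "h \<le> t"
  shows "base t (level t (forest h S K))"
  using assms(2)
proof (induction t rule: dec_induct)
  case base
  then show ?case using assms by (simp add: level_forest_base)
next
  case (step n)
  then show ?case by (auto simp: level_forest_Suc base_def)
qed

lemma card_level_forest_Suc:
  assumes "base h S"
  shows "card (level (Suc h) (forest h S K)) = (\<Sum>u\<in>S. K u)"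
proof -
  have "card (level (Suc h) (forest h S K)) = card (\<Union>u\<in>S. (\<lambda>i. u @ [i]) ` {..<K u})"
    using assms by (simp add: level_forest_Suc level_forest_base)
  also have "\<dots> = (\<Sum>u\<in>S. card ((\<lambda>i. u @ [i]) ` {..<K u}))"
    using assms by (intro card_UN_disjoint) (auto simp: base_def)
  also have "\<dots> = (\<Sum>u\<in>S. K u)" by (intro sum.cong) (auto simp: card_image inj_on_def)
  finally show ?thesis .
qed

text \<open>The deterministic half of the branching property: cutting a forest at level
  \<open>t\<close> and regrowing it from the cut with the same offspring numbers gives back its
  upper part.\<close>

lemma forest_level_forest:
  assumes "h \<le> t"
  shows "forest t (level t (forest h S K)) K = {u \<in> forest h S K. t \<le> length u}"
proof -
  have "u \<in> forest t (level t (forest h S K)) K \<longleftrightarrow> u \<in> {u \<in> forest h S K. t \<le> length u}" for u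
  proof (cases "t \<le> length u")
    case True
    have "{h..<length u} = {h..<t} \<union> {t..<length u}" using True assms by auto
    then show ?thesis using True assms by (auto simp: level_def forest_def min_def)
  qed (auto simp: forest_def)
  then show ?thesis by blast
qed

lemma level_forest_level_forest:
  assumes "h \<le> t" "t \<le> s"
  shows "level s (forest t (level t (forest h S K)) K) = level s (forest h S K)"
  unfolding forest_level_forest[OF assms(1)] using assms by (auto simp: level_def)

lemma forest_cong:
  assumes "\<And>u. h \<le> length u \<Longrightarrow> take h u \<in> S \<Longrightarrow> K u = K' u"
  shows "forest h S K = forest h S K'"
  unfolding forest_def using assms by (intro Collect_cong conj_cong refl ball_cong) (auto simp: min_def)

lemma level_forest_cong:
  assumes "\<And>u. h \<le> length u \<Longrightarrow> length u < t \<Longrightarrow> K u = K' u"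
  shows "level t (forest h S K) = level t (forest h S K')"
proof -
  have "(u ! i < K (take i u)) = (u ! i < K' (take i u))"
    if "length u = t" "i \<in> {h..<length u}" for u i
    using that assms[of "take i u"] by (auto simp: min_def)
  then show ?thesis unfolding level_def forest_def by (auto simp: all_conj_distrib)
qed

lemma truncate_tree_eq_levels:
  "truncate_tree t \<tau> = (\<Union>s\<le>t. level s \<tau>)"
  by (auto simp: truncate_tree_def level_def)

lemma finite_truncate_forest:
  assumes "base h S"
  shows "finite (truncate_tree t (forest h S K))"
proof (rule finite_subset)
  show "truncate_tree t (forest h S K) \<subseteq> (\<Union>s\<in>{h..t}. level s (forest h S K))"
    by (auto simp: truncate_tree_def level_def forest_def)
  show "finite (\<Union>s\<in>{h..t}. level s (forest h S K))"
    using base_level_forest[OF assms] by (auto simp: base_def)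
qed

text \<open>Truncated forests are finite sets of words, of which there are countably many. It thus
  suffices to treat single values, and afterwards every function of a truncation is measurable,
  including \<open>wide\<close> with its existential quantifier over potentials.\<close>

lemma measurable_truncate_forest:
  assumes "base h S"
  shows "(\<lambda>K. truncate_tree t (forest h S K)) \<in> offspring_field \<mu> \<rightarrow>\<^sub>M count_space {s. finite s}"
proof -
  have countable: "countable {s::nat list set. finite s}" by (rule countable_Collect_finite)
  have "(\<lambda>K. truncate_tree t (forest h S K)) -` {s} \<inter> space (offspring_field \<mu>) \<in> sets (offspring_field \<mu>)"
    for s
  proof -
    have eq: "(\<lambda>K. truncate_tree t (forest h S K)) -` {s} \<inter> space (offspring_field \<mu>) =
      {K \<in> space (offspring_field \<mu>). \<forall>u. ((h \<le> length u \<and> take h u \<in> S \<and>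
         (\<forall>i\<in>{h..<length u}. u ! i < K (take i u))) \<and> length u \<le> t) = (u \<in> s)}"
      by (auto simp: truncate_tree_def forest_def)
    show ?thesis unfolding eq by measurable
  qed
  then show ?thesis
    unfolding measurable_count_space_eq_countable[OF countable] using finite_truncate_forest[OF assms] by auto
qed

lemma measurable_forest_truncated:
  assumes "base h S" "\<And>K. g (forest h S K) = g' (truncate_tree t (forest h S K))" "range g' \<subseteq> space N"
  shows "(\<lambda>K. g (forest h S K)) \<in> offspring_field \<mu> \<rightarrow>\<^sub>M N"
  unfolding assms(2)
  by (rule measurable_compose[OF measurable_truncate_forest[OF assms(1)]]) (use assms(3) in auto)

lemma measurable_level_forest:
  assumes "base h S" "h \<le> t"
  shows "(\<lambda>K. level t (forest h S K)) \<in> offspring_field \<mu> \<rightarrow>\<^sub>M count_space {s. base t s}"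
proof -
  have "(\<lambda>K. level t (forest h S K)) = (\<lambda>K. {u \<in> truncate_tree t (forest h S K). length u = t})"
    by (auto simp: level_def truncate_tree_def)
  also have "\<dots> \<in> offspring_field \<mu> \<rightarrow>\<^sub>M count_space {s. base t s}"
    by (rule measurable_compose[OF measurable_truncate_forest[OF assms(1)]]) (auto simp: base_def)
  finally show ?thesis .
qed

lemma measurable_card_level_forest [measurable]:
  assumes "base h S"
  shows "(\<lambda>K. card (level t (forest h S K))) \<in> offspring_field \<mu> \<rightarrow>\<^sub>M count_space UNIV"
proof (rule measurable_forest_truncated[OF assms])
  show "card (level t (forest h S K)) = card (level t (truncate_tree t (forest h S K)))" for K
    by (intro arg_cong[where f = card]) (auto simp: level_def truncate_tree_def)
qed auto

lemma pred_wide_forest [measurable]: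
  assumes "base h S"
  shows "Measurable.pred (offspring_field \<mu>) (\<lambda>K. wide (forest h S K) a b l)"
proof (rule measurable_forest_truncated[OF assms])
  show "wide (forest h S K) a b l = wide (truncate_tree b (forest h S K)) a b l" for K
    by (rule wide_cong) (auto simp: truncate_tree_def)
qed auto

lemma measurable_compose_level_forest:
  assumes "base h S" "h \<le> t" "\<And>s. base t s \<Longrightarrow> \<Psi> s \<in> offspring_field \<mu> \<rightarrow>\<^sub>M N"
  shows "(\<lambda>K. \<Psi> (level t (forest h S K)) K) \<in> offspring_field \<mu> \<rightarrow>\<^sub>M N"
proof (rule measurable_compose_countable'[OF _ measurable_level_forest[OF assms(1,2)]])
  have "{s. base t s} \<subseteq> {s. finite s}" by (auto simp: base_def)
  then show "countable {s. base t s}" by (rule countable_subset) (rule countable_Collect_finite)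
qed (use assms(3) in auto)

text \<open>Resampling the words shorter than \<open>t\<close> separates the two sources of
  randomness: level \<open>t\<close> is a function of the first field alone, and
  \<open>\<Psi>\<close> at a fixed level is a function of the second.\<close>

lemma nn_integral_branching:
  assumes S: "base h S" and t: "h \<le> t"
    and m: "\<And>s. base t s \<Longrightarrow> \<Psi> s \<in> borel_measurable (offspring_field \<mu>)"
    and d: "\<And>s. base t s \<Longrightarrow> determined_by (\<Psi> s) {u. t \<le> length u}"
  shows "(\<integral>\<^sup>+ K. \<Psi> (level t (forest h S K)) K \<partial>offspring_field \<mu>) =
    (\<integral>\<^sup>+ K'. (\<integral>\<^sup>+ K. \<Psi> (level t (forest h S K')) K \<partial>offspring_field \<mu>) \<partial>offspring_field \<mu>)"
proof -
  let ?J = "{u. length u < t}"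
  have "level t (forest h S (overwrite ?J K' K)) = level t (forest h S K')" for K' K
    by (rule level_forest_cong) (simp add: overwrite_def)
  moreover have "\<Psi> (level t (forest h S K')) (overwrite ?J K' K) = \<Psi> (level t (forest h S K')) K" for K' K
    by (rule determined_byD[OF d[OF base_level_forest[OF S t]]]) (simp add: overwrite_def)
  ultimately show ?thesis
    using measurable_compose_level_forest[OF S t m]
    by (subst nn_integral_overwrite[where J = ?J]) simp_all
qed

lemma determined_by_forest: "determined_by (\<lambda>K. g (forest h S K)) {u. h \<le> length u \<and> take h u \<in> S}"
  unfolding determined_by_def using forest_cong by (metis (mono_tags, lifting) mem_Collect_eq)

lemma determined_by_mono: "determined_by g I \<Longrightarrow> I \<subseteq> J \<Longrightarrow> determined_by g J"
  unfolding determined_by_def by blast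

lemma nn_integral_branching_forest:
  assumes S: "base h S" and t: "h \<le> t"
    and m: "\<And>s. base t s \<Longrightarrow> (\<lambda>K. \<Psi> s (forest t s K)) \<in> borel_measurable (offspring_field \<mu>)"
  shows "(\<integral>\<^sup>+ K. \<Psi> (level t (forest h S K)) (forest t (level t (forest h S K)) K) \<partial>offspring_field \<mu>) =
    (\<integral>\<^sup>+ K'. (\<integral>\<^sup>+ K. \<Psi> (level t (forest h S K')) (forest t (level t (forest h S K')) K) \<partial>offspring_field \<mu>) \<partial>offspring_field \<mu>)"
  by (rule nn_integral_branching[where \<Psi> = "\<lambda>s K. \<Psi> s (forest t s K)", OF S t m])
    (auto intro: determined_by_mono[OF determined_by_forest])

section \<open>Moments, extinction and blocks\<close>

lemma prob_indep:
  assumes [measurable]: "Measurable.pred (offspring_field \<mu>) P" "Measurable.pred (offspring_field \<mu>) R"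
    and P: "determined_by P I" and R: "determined_by R J" and IJ: "I \<inter> J = {}"
  shows "measure (offspring_field \<mu>) {K. P K \<and> R K} =
    measure (offspring_field \<mu>) {K. P K} * measure (offspring_field \<mu>) {K. R K}"
proof -
  let ?Q = "offspring_field \<mu>"
  have [measurable]: "{K. P K} \<in> sets ?Q" "{K. R K} \<in> sets ?Q" "{K. P K \<and> R K} \<in> sets ?Q"
    using assms(1,2) pred_intros_logic(3)[OF assms(1,2)] by (simp_all add: pred_def)
  have d: "determined_by (indicator {K. P K} :: _ \<Rightarrow> ennreal) I"
    "determined_by (indicator {K. R K} :: _ \<Rightarrow> ennreal) J"
    using P R unfolding determined_by_def indicator_def by (smt (verit) mem_Collect_eq)+
  have "emeasure ?Q {K. P K \<and> R K} = (\<integral>\<^sup>+K. indicator {K. P K \<and> R K} K \<partial>?Q)"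
    by simp
  also have "\<dots> = (\<integral>\<^sup>+K. indicator {K. P K} K * indicator {K. R K} K \<partial>?Q)"
    by (intro nn_integral_cong) (simp add: indicator_def)
  also have "\<dots> = emeasure ?Q {K. P K} * emeasure ?Q {K. R K}"
    by (subst nn_integral_indep[OF _ _ d IJ]) auto
  finally show ?thesis
    by (simp add: offspring_field.P.emeasure_eq_measure flip: ennreal_mult)
qed

lemma forest_left_of:
  assumes "base h S1" "base h S2" "\<And>u v. u \<in> S1 \<Longrightarrow> v \<in> S2 \<Longrightarrow> u \<lhd> v"
    and "u \<in> forest h S1 K" "v \<in> forest h S2 K" "length u = length v"
  shows "u \<lhd> v"
proof -
  have "take h u \<lhd> take h v" using assms by (auto simp: forest_def)
  then have "take h u @ drop h u \<lhd> take h v @ drop h v"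
    using assms by (intro left_of_append) auto
  then show ?thesis by simp
qed

lemma wide_forest_Un:
  assumes "base h S1" "base h S2" "\<And>u v. u \<in> S1 \<Longrightarrow> v \<in> S2 \<Longrightarrow> u \<lhd> v"
    and "wide (forest h S1 K) h b l1" "wide (forest h S2 K) h b l2"
  shows "wide (forest h (S1 \<union> S2) K) h b (l1 + l2)"
  unfolding forest_Un
proof (rule wide_Un[OF assms(4,5)])
  have "S1 \<inter> S2 = {}" using assms(3) left_of_irrefl by blast
  then show "\<And>u i. u \<in> forest h S1 K \<Longrightarrow> u @ [i] \<in> forest h S2 K \<Longrightarrow> h \<le> length u \<Longrightarrow> False"
    "\<And>u i. u \<in> forest h S2 K \<Longrightarrow> u @ [i] \<in> forest h S1 K \<Longrightarrow> h \<le> length u \<Longrightarrow> False"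
    by (auto simp: forest_snoc) (auto simp: forest_def)
qed (use forest_left_of[OF assms(1-3)] in blast)

lemma base_subset: "base h S \<Longrightarrow> T \<subseteq> S \<Longrightarrow> base h T"
  by (auto simp: base_def intro: finite_subset)

text \<open>A Chernoff bound for the number of wide blocks among \<open>B\<close> consecutive ones.\<close>

lemma prob_not_wide_blocks:
  assumes good: "\<And>h S. base h S \<Longrightarrow> card S = n \<Longrightarrow>
      measure (offspring_field \<mu>) {K. \<not> wide (forest h S K) h (h + H) l} \<le> 1 / 2"
    and "base h S" "B * n \<le> card S"
  shows "measure (offspring_field \<mu>) {K. \<not> wide (forest h S K) h (h + H) (b * l)} \<le> 2 ^ b * (3 / 4) ^ B"
  using assms(2,3)
proof (induction B arbitrary: S b)
  case 0
  have "measure (offspring_field \<mu>) {K. \<not> wide (forest h S K) h (h + H) (b * l)} \<le> 1"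
    by simp
  also have "\<dots> \<le> (2::real) ^ b" by simp
  finally show ?case by simp
next
  case (Suc B)
  let ?P = "measure (offspring_field \<mu>)"
  show ?case
  proof (cases b)
    case 0
    then show ?thesis by (simp add: wide_0)
  next
    case b: (Suc b')
    have "n \<le> card S" using Suc.prems by simp
    then obtain S1 S2 where S: "S = S1 \<union> S2" "S1 \<inter> S2 = {}" "card S1 = n" "card S2 = card S - n"
      "\<And>u v. u \<in> S1 \<Longrightarrow> v \<in> S2 \<Longrightarrow> u \<lhd> v"
      using split_rightmost[of S h n] Suc.prems(1) unfolding base_def by blast
    have bs [simp]: "base h S1" "base h S2" "base h S"
      using base_subset[OF Suc.prems(1)] S(1) Suc.prems(1) by auto
    define W where "W T c K = wide (forest h T K) h (h + H) c" for T c K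
    have W: "Measurable.pred (offspring_field \<mu>) (W T c)" if "base h T" for T c
      unfolding W_def by (rule pred_wide_forest[OF that])
    have sets: "{K. P K} \<in> sets (offspring_field \<mu>)" if "Measurable.pred (offspring_field \<mu>) P" for P
      using that by (simp add: pred_def)
    have pred1: "Measurable.pred (offspring_field \<mu>) (W S1 l)"
      and pred1': "Measurable.pred (offspring_field \<mu>) (\<lambda>K. \<not> W S1 l K)"
      and pred2: "\<And>c. Measurable.pred (offspring_field \<mu>) (\<lambda>K. \<not> W S2 c K)"
      using W bs by (auto intro!: pred_intros_logic(2))
    note sets1 = sets[OF pred_intros_logic(3)[OF pred1 pred2]]
      and sets1' = sets[OF pred_intros_logic(3)[OF pred1' pred2]]
    have d: "determined_by (\<lambda>K. G (W S1 l K)) {u. h \<le> length u \<and> take h u \<in> S1}" for G :: "bool \<Rightarrow> bool"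
      unfolding W_def by (rule determined_by_forest[of "\<lambda>X. G (wide X h (h + H) l)"])
    have d2: "determined_by (\<lambda>K. \<not> W S2 c K) {u. h \<le> length u \<and> take h u \<in> S2}" for c
      unfolding W_def by (rule determined_by_forest[of "\<lambda>X. \<not> wide X h (h + H) c"])
    have disj: "{u. h \<le> length u \<and> take h u \<in> S1} \<inter> {u. h \<le> length u \<and> take h u \<in> S2} = {}"
      using S(2) by auto
    note indep = prob_indep[OF pred1 pred2 d[of "\<lambda>x. x"] d2 disj]
      and indep' = prob_indep[OF pred1' pred2 d[of Not] d2 disj]
    define x where "x = ?P {K. \<not> W S1 l K}"
    define \<beta> where "\<beta> = (3 / 4 :: real) ^ B"
    have x: "x \<le> 1 / 2" unfolding x_def W_def using good S(3) by simp
    have x0: "0 \<le> x" unfolding x_def by simp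
    have x1: "?P {K. W S1 l K} = 1 - x"
      unfolding x_def using offspring_field.P.prob_neg[of \<mu> "W S1 l"] sets[OF pred1] by simp
    have \<alpha>: "?P {K. \<not> W S2 (c * l) K} \<le> 2 ^ c * \<beta>" for c
      unfolding W_def \<beta>_def using Suc.IH[OF bs(2)] S(4) Suc.prems(2) by simp
    \<comment> \<open>The leftmost block is peeled off. If it is wide, the remaining blocks must
      contribute only \<open>b'\<close> further units; otherwise it counts as cost 0 and they must
      contribute all \<open>b\<close>.\<close>
    have "?P {K. \<not> W S (b * l) K} \<le> ?P ({K. W S1 l K \<and> \<not> W S2 (b' * l) K} \<union> {K. \<not> W S1 l K \<and> \<not> W S2 (b * l) K})"
    proof (rule offspring_field.P.finite_measure_mono)
      show "{K. \<not> W S (b * l) K} \<subseteq> {K. W S1 l K \<and> \<not> W S2 (b' * l) K} \<union> {K. \<not> W S1 l K \<and> \<not> W S2 (b * l) K}"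
        using wide_forest_Un[OF bs(1,2) S(5), of _ "h + H" l "b' * l"]
          wide_forest_Un[OF bs(1,2) S(5), of _ "h + H" 0 "b * l"]
        unfolding W_def S(1) b by (auto simp: wide_0)
    qed (intro sets.Un sets1 sets1')
    also have "\<dots> \<le> ?P {K. W S1 l K \<and> \<not> W S2 (b' * l) K} + ?P {K. \<not> W S1 l K \<and> \<not> W S2 (b * l) K}"
      by (rule measure_Un_le[OF sets1 sets1'])
    also have "\<dots> = (1 - x) * ?P {K. \<not> W S2 (b' * l) K} + x * ?P {K. \<not> W S2 (b * l) K}"
      using indep indep' x1 by (simp add: x_def)
    also have "\<dots> \<le> (1 - x) * (2 ^ b' * \<beta>) + x * (2 ^ b * \<beta>)"
      using x x0 by (intro add_mono mult_left_mono \<alpha>) auto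
    \<comment> \<open>A block that is wide with probability \<open>1 - x\<close> multiplies the
      bound by \<open>(1 - x) / 2 + x\<close>, and \<open>x\<close> is at most \<open>1 / 2\<close>.
      This is the exponential Markov inequality with weight \<open>1 / 2\<close> per wide
      block.\<close>
    also have "\<dots> = 2 ^ b * \<beta> * ((1 + x) / 2)" by (simp add: b algebra_simps)
    also have "\<dots> \<le> 2 ^ b * \<beta> * (3 / 4)" using x by (intro mult_left_mono) (auto simp: \<beta>_def)
    finally show ?thesis unfolding W_def \<beta>_def by simp
  qed
qed

text \<open>Here \<open>\<sigma>2\<close> is the variance. The last assumption, a quadratic lower
  bound on the generating function at \<open>1 - q\<close>, records that the law is not degenerate;
  it controls survival probabilities.\<close>

locale critical_offspring =
  fixes \<mu> :: "nat pmf" and \<sigma>2 \<kappa> :: real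
  assumes mean: "(\<integral>\<^sup>+ k. ennreal (real k) \<partial>\<mu>) = 1"
    and second: "(\<integral>\<^sup>+ k. ennreal ((real k)\<^sup>2) \<partial>\<mu>) = ennreal (1 + \<sigma>2)"
    and \<sigma>2: "0 \<le> \<sigma>2" and \<kappa>: "0 < \<kappa>" "\<kappa> \<le> 1"
    and generating: "\<And>q. 0 \<le> q \<Longrightarrow> q \<le> 1 \<Longrightarrow>
      ennreal (1 - q + \<kappa> * q\<^sup>2) \<le> (\<integral>\<^sup>+ k. ennreal ((1 - q) ^ k) \<partial>\<mu>)"
begin

abbreviation "Q \<equiv> offspring_field \<mu>"

section \<open>Moments of level sizes and extinction\<close>

lemma nn_integral_sum_offspring:
  assumes "finite S"
  shows "(\<integral>\<^sup>+ K. ennreal (real (\<Sum>u\<in>S. K u)) \<partial>Q) = ennreal (real (card S))"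
  using assms
proof (induction S rule: finite_induct)
  case (insert v S)
  have "(\<integral>\<^sup>+ K. ennreal (real (\<Sum>u\<in>insert v S. K u)) \<partial>Q) =
      (\<integral>\<^sup>+ K. ennreal (real (K v)) + ennreal (real (\<Sum>u\<in>S. K u)) \<partial>Q)"
    using insert by (simp add: sum_nonneg ennreal_plus)
  also have "\<dots> = (\<integral>\<^sup>+ K. ennreal (real (K v)) \<partial>Q) + (\<integral>\<^sup>+ K. ennreal (real (\<Sum>u\<in>S. K u)) \<partial>Q)"
    by (rule nn_integral_add) measurable
  also have "\<dots> = 1 + ennreal (real (card S))"
    using insert nn_integral_offspring[where f = "\<lambda>k. ennreal (real k)"] mean by simp
  also have "\<dots> = ennreal (real (card (insert v S)))"
    using insert by (simp flip: ennreal_plus ennreal_1)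
  finally show ?case .
qed simp

text \<open>Variances of independent offspring numbers add up; in the induction step the mixed term
  factors by independence.\<close>

lemma nn_integral_sum_offspring_square:
  assumes "finite S"
  shows "(\<integral>\<^sup>+ K. ennreal ((real (\<Sum>u\<in>S. K u))\<^sup>2) \<partial>Q) = ennreal ((real (card S))\<^sup>2 + \<sigma>2 * real (card S))"
  using assms
proof (induction S rule: finite_induct)
  case (insert v S)
  let ?X = "\<lambda>K :: nat list \<Rightarrow> nat. real (\<Sum>u\<in>S. K u)" and ?n = "real (card S)"
  have "(\<integral>\<^sup>+ K. ennreal ((real (\<Sum>u\<in>insert v S. K u))\<^sup>2) \<partial>Q) =
      (\<integral>\<^sup>+ K. ennreal ((real (K v))\<^sup>2) + (ennreal 2 * (ennreal (real (K v)) * ennreal (?X K)) + ennreal ((?X K)\<^sup>2)) \<partial>Q)"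
  proof (intro nn_integral_cong)
    fix K :: "nat list \<Rightarrow> nat"
    have X: "0 \<le> ?X K" by (rule of_nat_0_le_iff)
    have "(real (\<Sum>u\<in>insert v S. K u))\<^sup>2 = (real (K v))\<^sup>2 + (2 * (real (K v) * ?X K) + (?X K)\<^sup>2)"
      using insert by (simp add: power2_sum)
    then show "ennreal ((real (\<Sum>u\<in>insert v S. K u))\<^sup>2) =
      ennreal ((real (K v))\<^sup>2) + (ennreal 2 * (ennreal (real (K v)) * ennreal (?X K)) + ennreal ((?X K)\<^sup>2))"
      using X by (simp only: ennreal_mult ennreal_plus mult_nonneg_nonneg add_nonneg_nonneg
          zero_le_power2 of_nat_0_le_iff zero_le_numeral)
  qed
  also have "\<dots> = (\<integral>\<^sup>+ K. ennreal ((real (K v))\<^sup>2) \<partial>Q) +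
      (ennreal 2 * (\<integral>\<^sup>+ K. ennreal (real (K v)) * ennreal (?X K) \<partial>Q) + (\<integral>\<^sup>+ K. ennreal ((?X K)\<^sup>2) \<partial>Q))"
    by (simp add: nn_integral_add nn_integral_cmult del: of_nat_sum)
  also have "(\<integral>\<^sup>+ K. ennreal (real (K v)) * ennreal (?X K) \<partial>Q) =
      (\<integral>\<^sup>+ K. ennreal (real (K v)) \<partial>Q) * (\<integral>\<^sup>+ K. ennreal (?X K) \<partial>Q)"
  proof (rule nn_integral_indep)
    show "determined_by (\<lambda>K. ennreal (real (K v))) {v}" by (simp add: determined_by_def)
    show "determined_by (\<lambda>K. ennreal (?X K)) S"
      by (auto simp: determined_by_def intro!: arg_cong[where f = ennreal] sum.cong)
  qed (use insert in auto)
  also have "\<dots> = ennreal ?n"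
    using nn_integral_sum_offspring[OF insert(1)] nn_integral_offspring[where f = "\<lambda>k. ennreal (real k)" and u = v and \<mu> = \<mu>] mean by simp
  also have "(\<integral>\<^sup>+ K. ennreal ((real (K v))\<^sup>2) \<partial>Q) = ennreal (1 + \<sigma>2)"
    using nn_integral_offspring[where f = "\<lambda>k. ennreal ((real k)\<^sup>2)" and u = v and \<mu> = \<mu>] second by simp
  also have "ennreal (1 + \<sigma>2) + (ennreal 2 * ennreal ?n + (\<integral>\<^sup>+ K. ennreal ((?X K)\<^sup>2) \<partial>Q))
      = ennreal (1 + \<sigma>2 + (2 * ?n + (?n\<^sup>2 + \<sigma>2 * ?n)))"
    using \<sigma>2 by (simp only: insert.IH ennreal_mult[symmetric] ennreal_plus[symmetric]
      add_nonneg_nonneg mult_nonneg_nonneg of_nat_0_le_iff zero_le_power2 zero_le_one zero_le_numeral)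
  also have "1 + \<sigma>2 + (2 * ?n + (?n\<^sup>2 + \<sigma>2 * ?n)) = (real (card (insert v S)))\<^sup>2 + \<sigma>2 * real (card (insert v S))"
    using insert by (simp add: power2_eq_square algebra_simps)
  finally show ?case .
qed simp

lemma nn_integral_power_sum_offspring:
  assumes "finite S" "0 \<le> s"
  shows "(\<integral>\<^sup>+ K. ennreal (s ^ (\<Sum>u\<in>S. K u)) \<partial>Q) = (\<integral>\<^sup>+ k. ennreal (s ^ k) \<partial>\<mu>) ^ card S"
  using assms(1)
proof (induction S rule: finite_induct)
  case (insert v S)
  have "(\<integral>\<^sup>+ K. ennreal (s ^ (\<Sum>u\<in>insert v S. K u)) \<partial>Q) =
      (\<integral>\<^sup>+ K. ennreal (s ^ K v) * ennreal (s ^ (\<Sum>u\<in>S. K u)) \<partial>Q)"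
    using insert assms(2) by (simp add: power_add ennreal_mult)
  also have "\<dots> = (\<integral>\<^sup>+ K. ennreal (s ^ K v) \<partial>Q) * (\<integral>\<^sup>+ K. ennreal (s ^ (\<Sum>u\<in>S. K u)) \<partial>Q)"
  proof (rule nn_integral_indep)
    show "determined_by (\<lambda>K. ennreal (s ^ K v)) {v}" by (simp add: determined_by_def)
    show "determined_by (\<lambda>K. ennreal (s ^ (\<Sum>u\<in>S. K u))) S"
      by (auto simp: determined_by_def intro!: arg_cong[where f = "\<lambda>n. ennreal (s ^ n)"] sum.cong)
  qed (use insert in auto)
  also have "\<dots> = (\<integral>\<^sup>+ k. ennreal (s ^ k) \<partial>\<mu>) ^ card (insert v S)"
    using insert nn_integral_offspring[where f = "\<lambda>k. ennreal (s ^ k)" and u = v and \<mu> = \<mu>] by simp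
  finally show ?case .
qed simp

text \<open>The first generation serves as the base of a new forest. Inductions on the height
  therefore vary both \<open>h\<close> and \<open>S\<close>.\<close>

lemma nn_integral_first_step:
  assumes S: "base h S"
    and m: "\<And>s. base (Suc h) s \<Longrightarrow> (\<lambda>K. \<Psi> (forest (Suc h) s K)) \<in> borel_measurable Q"
  shows "(\<integral>\<^sup>+ K. \<Psi> (forest (Suc h) (level (Suc h) (forest h S K)) K) \<partial>Q) =
    (\<integral>\<^sup>+ K'. (\<integral>\<^sup>+ K. \<Psi> (forest (Suc h) (level (Suc h) (forest h S K')) K) \<partial>Q) \<partial>Q)"
  by (rule nn_integral_branching_forest[where \<Psi> = "\<lambda>_. \<Psi>", OF S _ m]) auto

lemma level_forest_first_step:
  "level (Suc h + R) (forest (Suc h) (level (Suc h) (forest h S K)) K) = level (h + Suc R) (forest h S K)"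
  by (subst level_forest_level_forest) auto

text \<open>The mean level size is preserved, so every generation adds the same variance,
  \<open>\<sigma>2\<close> times the initial size.\<close>

lemma nn_integral_level_square:
  assumes "base h S"
  shows "(\<integral>\<^sup>+ K. ennreal ((real (card (level (h + R) (forest h S K))))\<^sup>2) \<partial>Q) =
    ennreal ((real (card S))\<^sup>2 + \<sigma>2 * real (card S) * real R)"
  using assms
proof (induction R arbitrary: h S)
  case 0
  then show ?case by (simp add: level_forest_base)
next
  case (Suc R)
  let ?z = "real (card S)" and ?Z = "\<lambda>K. real (card (level (Suc h) (forest h S K)))"
  have fin: "finite S" using Suc.prems by (simp add: base_def)
  have "(\<integral>\<^sup>+ K. ennreal ((real (card (level (h + Suc R) (forest h S K))))\<^sup>2) \<partial>Q) =
     (\<integral>\<^sup>+ K. ennreal ((real (card (level (Suc h + R) (forest (Suc h) (level (Suc h) (forest h S K)) K))))\<^sup>2) \<partial>Q)"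
    by (simp only: level_forest_first_step)
  also have "\<dots> = (\<integral>\<^sup>+ K'. \<integral>\<^sup>+ K. ennreal ((real (card (level (Suc h + R) (forest (Suc h) (level (Suc h) (forest h S K')) K))))\<^sup>2) \<partial>Q \<partial>Q)"
    by (rule nn_integral_first_step[OF Suc.prems])
      (rule measurable_compose[OF measurable_card_level_forest], auto)
  also have "\<dots> = (\<integral>\<^sup>+ K'. ennreal ((?Z K')\<^sup>2 + \<sigma>2 * ?Z K' * real R) \<partial>Q)"
    by (intro nn_integral_cong Suc.IH base_level_forest[OF Suc.prems]) simp
  also have "\<dots> = (\<integral>\<^sup>+ K'. ennreal ((?Z K')\<^sup>2) + ennreal (\<sigma>2 * real R) * ennreal (?Z K') \<partial>Q)"
    using \<sigma>2 by (intro nn_integral_cong) (simp add: ennreal_plus mult_ac flip: ennreal_mult)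
  also have "\<dots> = (\<integral>\<^sup>+ K'. ennreal ((?Z K')\<^sup>2) \<partial>Q) + ennreal (\<sigma>2 * real R) * (\<integral>\<^sup>+ K'. ennreal (?Z K') \<partial>Q)"
  proof -
    have "(\<lambda>K. f (card (level (Suc h) (forest h S K)))) \<in> borel_measurable Q" for f :: "nat \<Rightarrow> ennreal"
      by (rule measurable_compose[OF measurable_card_level_forest[OF Suc.prems]]) simp
    from this[of "\<lambda>n. ennreal ((real n)\<^sup>2)"] this[of "\<lambda>n. ennreal (real n)"] show ?thesis
      by (simp add: nn_integral_add nn_integral_cmult)
  qed
  also have "\<dots> = ennreal (?z\<^sup>2 + \<sigma>2 * ?z) + ennreal (\<sigma>2 * real R) * ennreal ?z"
    using nn_integral_sum_offspring_square[OF fin] nn_integral_sum_offspring[OF fin]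
    by (simp add: card_level_forest_Suc[OF Suc.prems])
  also have "\<dots> = ennreal (?z\<^sup>2 + \<sigma>2 * ?z * real (Suc R))"
    using \<sigma>2 by (simp add: algebra_simps flip: ennreal_plus ennreal_mult)
  finally show ?case .
qed

text \<open>If one root is extinct by height \<open>R\<close> with probability at least
  \<open>1 - q\<close>, then conditioning on the first generation gives at least the generating
  function at \<open>1 - q\<close>, hence at least \<open>1 - q + \<kappa> * q\<^sup>2\<close>, for
  height \<open>R + 1\<close>. The values \<open>1 / (1 + \<kappa> * R)\<close> for \<open>q\<close>
  obey this recursion, which yields the Kolmogorov order \<open>1 / R\<close> for survival.\<close>

lemma prob_extinct_ge:
  assumes "base h S"
  shows "ennreal ((1 - 1 / (1 + \<kappa> * real R)) ^ card S) \<le> emeasure Q {K. level (h + R) (forest h S K) = {}}"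
  using assms
proof (induction R arbitrary: h S)
  case 0
  \<comment> \<open>At height 0 the bound is \<open>0 ^ card S\<close>, which is 1 exactly for the
    empty base.\<close>
  then show ?case
    by (cases "S = {}") (auto simp: level_forest_base base_def card_gt_0_iff zero_power)
next
  case (Suc R)
  have fin: "finite S" using Suc.prems by (simp add: base_def)
  have empty_iff: "level t (forest h S K) = {} \<longleftrightarrow> card (level t (forest h S K)) = 0"
    if "base h S" "h \<le> t" for t h S K
    using base_level_forest[OF that, of K] by (simp add: base_def)
  have meas: "{K. level t (forest h S K) = {}} \<in> sets Q" if "base h S" "h \<le> t" for t h S
  proof -
    have "Measurable.pred Q (\<lambda>K. card (level t (forest h S K)) = 0)"
      by (rule measurable_compose[OF measurable_card_level_forest[OF that(1)]]) simp
    then show ?thesis using empty_iff[OF that] by (simp add: pred_def)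
  qed
  have bl: "base (Suc h) (level (Suc h) (forest h S K))" for K
    by (rule base_level_forest[OF Suc.prems]) simp
  let ?q = "1 / (1 + \<kappa> * real R)"
  let ?ind = "\<lambda>h R. indicator {X. level (h + R) X = {}} :: nat list set \<Rightarrow> ennreal"
  have pos: "1 \<le> 1 + \<kappa> * real R" using \<kappa> by simp
  then have q: "0 \<le> ?q" "?q \<le> 1" by simp_all
  have ind: "(\<integral>\<^sup>+K. ?ind h R (forest h S K) \<partial>Q) = emeasure Q {K. level (h + R) (forest h S K) = {}}"
    if "base h S" for h S R
  proof -
    have "(\<integral>\<^sup>+K. ?ind h R (forest h S K) \<partial>Q) = (\<integral>\<^sup>+K. indicator {K. level (h + R) (forest h S K) = {}} K \<partial>Q)"
      by (intro nn_integral_cong) (simp add: indicator_def)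
    also have "\<dots> = emeasure Q {K. level (h + R) (forest h S K) = {}}"
      using meas[OF that, of "h + R"] by simp
    finally show ?thesis .
  qed
  \<comment> \<open>With \<open>q = 1 / x\<close>, the recursion needs
    \<open>1 / x - \<kappa> / x\<^sup>2\<close> to be at most \<open>1 / (x + \<kappa>)\<close>,
    that is, \<open>x\<^sup>2 - \<kappa>\<^sup>2\<close> to be at most
    \<open>x\<^sup>2\<close>.\<close>
  have qq: "1 - 1 / (1 + \<kappa> * real (Suc R)) \<le> 1 - ?q + \<kappa> * ?q\<^sup>2"
  proof -
    define x where "x = 1 + \<kappa> * real R"
    have "x \<ge> 1" using pos by (simp add: x_def)
    then have x: "x \<ge> 1" "x > 0" "x + \<kappa> > 0" using \<kappa> by auto
    have "(x - \<kappa>) * (x + \<kappa>) \<le> x * x" by (simp add: algebra_simps)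
    then have "(x - \<kappa>) / (x * x) \<le> 1 / (x + \<kappa>)"
      using x by (simp add: divide_simps mult.commute)
    moreover have "(x - \<kappa>) / (x * x) = 1 / x - \<kappa> * (1 / x)\<^sup>2"
      using x by (simp add: field_simps power2_eq_square)
    moreover have "1 + \<kappa> * real (Suc R) = x + \<kappa>" by (simp add: x_def algebra_simps)
    ultimately show ?thesis unfolding x_def[symmetric] by (simp only:)
  qed
  have "1 \<le> 1 + \<kappa> * real (Suc R)" using \<kappa> by simp
  then have le1: "1 / (1 + \<kappa> * real (Suc R)) \<le> 1" by simp
  have "ennreal ((1 - 1 / (1 + \<kappa> * real (Suc R))) ^ card S) \<le> ennreal ((1 - ?q + \<kappa> * ?q\<^sup>2) ^ card S)"
    using qq le1 by (intro ennreal_leI power_mono) linarith+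
  also have "\<dots> = ennreal (1 - ?q + \<kappa> * ?q\<^sup>2) ^ card S"
    using q \<kappa> by (intro ennreal_power[symmetric]) (simp add: add_nonneg_nonneg)
  also have "\<dots> \<le> (\<integral>\<^sup>+ k. ennreal ((1 - ?q) ^ k) \<partial>\<mu>) ^ card S"
    using q by (intro power_mono generating) auto
  also have "\<dots> = (\<integral>\<^sup>+ K. ennreal ((1 - ?q) ^ (\<Sum>u\<in>S. K u)) \<partial>Q)"
    using q by (intro nn_integral_power_sum_offspring[symmetric] fin) auto
  also have "\<dots> = (\<integral>\<^sup>+ K. ennreal ((1 - ?q) ^ card (level (Suc h) (forest h S K))) \<partial>Q)"
    by (simp add: card_level_forest_Suc[OF Suc.prems])
  also have "\<dots> \<le> (\<integral>\<^sup>+ K'. \<integral>\<^sup>+K. ?ind (Suc h) R (forest (Suc h) (level (Suc h) (forest h S K')) K) \<partial>Q \<partial>Q)"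
    by (intro nn_integral_mono) (simp only: ind[OF bl], rule Suc.IH[OF bl])
  also have "\<dots> = (\<integral>\<^sup>+ K. ?ind (Suc h) R (forest (Suc h) (level (Suc h) (forest h S K)) K) \<partial>Q)"
  proof (rule nn_integral_first_step[OF Suc.prems, symmetric])
    fix s assume s: "base (Suc h) s"
    have "(\<lambda>K. ?ind (Suc h) R (forest (Suc h) s K)) = indicator {K. level (Suc h + R) (forest (Suc h) s K) = {}}"
      by (auto simp: indicator_def)
    then show "(\<lambda>K. ?ind (Suc h) R (forest (Suc h) s K)) \<in> borel_measurable Q"
      using meas[OF s, of "Suc h + R"] by simp
  qed
  also have "\<dots> = (\<integral>\<^sup>+K. ?ind h (Suc R) (forest h S K) \<partial>Q)"
    by (simp only: indicator_def mem_Collect_eq level_forest_first_step)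
  also have "\<dots> = emeasure Q {K. level (h + Suc R) (forest h S K) = {}}" by (rule ind[OF Suc.prems])
  finally show ?case .
qed

end

section \<open>Renormalization\<close>

lemma wide_mono:
  assumes "wide X a b l" "l' \<le> l"
  shows "wide X a b l'"
proof (cases "l' = 0")
  case False
  with assms obtain \<phi> where ne: "\<forall>t\<in>{a..b}. \<exists>u\<in>X. length u = t" and p: "potential X a b l \<phi>"
    by (auto simp: wide_def)
  have step: "min x l' \<le> min y l' + 1" if "x \<le> y + 1" for x y :: nat using that by auto
  have "potential X a b l' (\<lambda>u. min (\<phi> u) l')"
    using p step assms(2) unfolding potential_def by (auto simp: min.coboundedI1)
  then show ?thesis using ne unfolding wide_def by blast
qed (simp add: wide_0)

lemma wide_forest_above:
  assumes "h \<le> t"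
  shows "wide (forest h S K) t b l \<longleftrightarrow> wide (forest t (level t (forest h S K)) K) t b l"
  by (rule wide_cong) (auto simp: forest_level_forest[OF assms])

lemma pred_compose_level_forest:
  assumes "base h S" "h \<le> t" "\<And>s. base t s \<Longrightarrow> Measurable.pred (offspring_field \<mu>) (\<lambda>K. P s (forest t s K))"
  shows "Measurable.pred (offspring_field \<mu>) (\<lambda>K. P (level t (forest h S K)) (forest t (level t (forest h S K)) K))"
  by (rule measurable_compose_level_forest[where \<Psi> = "\<lambda>s K. P s (forest t s K)", OF assms])

text \<open>Given the offspring numbers below height \<open>t\<close>, the forest above is one over
  a fixed base. A bound that is uniform over bases therefore survives averaging over the random
  level.\<close>

lemma prob_branching_le:
  assumes S: "base h S" "h \<le> t"
    and P: "\<And>s. base t s \<Longrightarrow> Measurable.pred (offspring_field \<mu>) (\<lambda>K. P s (forest t s K))"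
    and le: "\<And>s. base t s \<Longrightarrow> measure (offspring_field \<mu>) {K. P s (forest t s K)} \<le> \<epsilon>" and "0 \<le> \<epsilon>"
  shows "measure (offspring_field \<mu>) {K. P (level t (forest h S K)) (forest t (level t (forest h S K)) K)} \<le> \<epsilon>"
proof -
  let ?Q = "offspring_field \<mu>" and ?L = "\<lambda>K. level t (forest h S K)"
  have sets: "{K. P s (forest t s K)} \<in> sets ?Q" if "base t s" for s
    using P[OF that] by (simp add: pred_def)
  have ind: "(\<lambda>K. indicator {X. P s X} (forest t s K)) = indicator {K. P s (forest t s K)}" for s
    by (auto simp: indicator_def)
  have "{K. P (?L K) (forest t (?L K) K)} \<in> sets ?Q"
    using pred_compose_level_forest[OF S P] by (simp add: pred_def)
  then have "emeasure ?Q {K. P (?L K) (forest t (?L K) K)}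
      = (\<integral>\<^sup>+K. indicator {K. P (?L K) (forest t (?L K) K)} K \<partial>?Q)" by simp
  also have "\<dots> = (\<integral>\<^sup>+K. indicator {X. P (?L K) X} (forest t (?L K) K) \<partial>?Q)"
    by (intro nn_integral_cong) (simp add: indicator_def)
  also have "\<dots> = (\<integral>\<^sup>+K'. \<integral>\<^sup>+K. indicator {X. P (?L K') X} (forest t (?L K') K) \<partial>?Q \<partial>?Q)"
    by (rule nn_integral_branching_forest[where \<Psi> = "\<lambda>s. indicator {X. P s X}", OF S])
      (simp only: ind, rule borel_measurable_indicator, rule sets)
  also have "\<dots> \<le> (\<integral>\<^sup>+K'. ennreal \<epsilon> \<partial>?Q)"
  proof (rule nn_integral_mono)
    fix K' :: "nat list \<Rightarrow> nat"
    have b: "base t (?L K')" by (rule base_level_forest[OF S])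
    show "(\<integral>\<^sup>+K. indicator {X. P (?L K') X} (forest t (?L K') K) \<partial>?Q) \<le> ennreal \<epsilon>"
      unfolding ind using sets[OF b] le[OF b] by (simp add: offspring_field.P.emeasure_eq_measure ennreal_leI)
  qed
  also have "\<dots> = ennreal \<epsilon>" by simp
  finally show ?thesis using \<open>0 \<le> \<epsilon>\<close> by (simp add: offspring_field.P.emeasure_eq_measure)
qed

context critical_offspring
begin

section \<open>Levels that stay above half of their initial size\<close>

lemma pred_level_low:
  assumes "base h S"
  shows "Measurable.pred Q (\<lambda>K. \<exists>t\<le>R. real (card (level (h + t) (forest h S K))) < \<theta>)"
proof -
  have "Measurable.pred Q (\<lambda>K. real (card (level (h + t) (forest h S K))) < \<theta>)" for t
    by (rule measurable_compose[OF measurable_card_level_forest[OF assms]]) simp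
  then show ?thesis by measurable
qed

lemma sets_level_low:
  "base h S \<Longrightarrow> {K. \<exists>t\<le>R. real (card (level (h + t) (forest h S K))) < \<theta>} \<in> sets Q"
  using pred_level_low by (simp add: pred_def)

text \<open>Induction on \<open>R\<close>: the right-hand side is harmonic for the level size process,
  and at least 1 when the level size is below \<open>\<theta>\<close>.\<close>

lemma prob_level_low:
  assumes "base h S" "\<theta> < a"
  shows "emeasure Q {K. \<exists>t\<le>R. real (card (level (h + t) (forest h S K))) < \<theta>}
    \<le> ennreal (((real (card S) - a)\<^sup>2 + \<sigma>2 * real (card S) * real R) / (a - \<theta>)\<^sup>2)"
  using assms(1)
proof (induction R arbitrary: h S)
  case 0
  show ?case
  proof (cases "real (card S) < \<theta>")
    case True
    then have "(a - \<theta>)\<^sup>2 \<le> (real (card S) - a)\<^sup>2"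
      using assms(2) by (subst power2_commute, intro power_mono) auto
    then have "1 \<le> (real (card S) - a)\<^sup>2 / (a - \<theta>)\<^sup>2" using assms(2) by simp
    then show ?thesis using 0 True by (simp add: level_forest_base)
  qed (use 0 in \<open>simp add: level_forest_base\<close>)
next
  case (Suc R)
  let ?z = "real (card S)" and ?c = "(a - \<theta>)\<^sup>2"
  have c: "?c > 0" using assms(2) by simp
  show ?case
  proof (cases "?z < \<theta>")
    case True
    then have "(a - \<theta>)\<^sup>2 \<le> (?z - a)\<^sup>2"
      using assms(2) by (subst power2_commute, intro power_mono) auto
    also have "\<dots> \<le> (?z - a)\<^sup>2 + \<sigma>2 * ?z * real (Suc R)" using \<sigma>2 by simp
    finally have "1 \<le> ((?z - a)\<^sup>2 + \<sigma>2 * ?z * real (Suc R)) / ?c" using c by simp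
    then have "1 \<le> ennreal (((?z - a)\<^sup>2 + \<sigma>2 * ?z * real (Suc R)) / ?c)"
      using ennreal_leI by fastforce
    then show ?thesis by (rule order_trans[OF offspring_field.P.measure_le_1])
  next
    case False
    let ?low = "\<lambda>h R X. \<exists>t\<le>R. real (card (level (h + t) X)) < \<theta>"
    let ?L = "\<lambda>K. level (Suc h) (forest h S K)" and ?Z = "\<lambda>K. real (card (level (Suc h) (forest h S K)))"
    have sets: "{K. ?low h R (forest h S K)} \<in> sets Q" if "base h S" for h R S
      using pred_level_low[OF that] by (simp add: pred_def)
    have low_iff: "?low h (Suc R) (forest h S K) \<longleftrightarrow> ?low (Suc h) R (forest (Suc h) (?L K) K)" for K
    proof -
      have "?low h (Suc R) (forest h S K) \<longleftrightarrow>
        real (card (level h (forest h S K))) < \<theta> \<or> (\<exists>t\<le>R. real (card (level (h + Suc t) (forest h S K))) < \<theta>)"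
        by (metis Suc_le_mono add_0_right le0 not0_implies_Suc)
      then show ?thesis
        using False by (simp only: level_forest_base[OF Suc.prems] level_forest_first_step simp_thms)
    qed
    have fin: "finite S" using Suc.prems by (simp add: base_def)
    have meas: "(\<lambda>K. real (card (level (Suc h) (forest h S K)))) \<in> borel_measurable Q"
      by (rule measurable_compose[OF measurable_card_level_forest[OF Suc.prems]]) simp
    \<comment> \<open>The polynomial \<open>?g\<close> may have a negative linear coefficient, so
      its expectation is computed from the two moments with signed integrals.\<close>
    have hb1: "has_bochner_integral Q ?Z ?z"
    proof (rule has_bochner_integral_nn_integral)
      show "(\<integral>\<^sup>+ K. ennreal (?Z K) \<partial>Q) = ennreal ?z"
        by (simp only: card_level_forest_Suc[OF Suc.prems] nn_integral_sum_offspring[OF fin])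
    qed (use meas in auto)
    have hb2: "has_bochner_integral Q (\<lambda>K. (?Z K)\<^sup>2) (?z\<^sup>2 + \<sigma>2 * ?z)"
    proof (rule has_bochner_integral_nn_integral)
      show "(\<integral>\<^sup>+ K. ennreal ((?Z K)\<^sup>2) \<partial>Q) = ennreal (?z\<^sup>2 + \<sigma>2 * ?z)"
        by (simp only: card_level_forest_Suc[OF Suc.prems] nn_integral_sum_offspring_square[OF fin])
    qed (use meas \<sigma>2 in auto)
    let ?g = "\<lambda>z. ((z - a)\<^sup>2 + \<sigma>2 * z * real R) / ?c"
    have hbc: "has_bochner_integral Q (\<lambda>_. a\<^sup>2 / ?c) (a\<^sup>2 / ?c)"
      using offspring_field.P.prob_space[of \<mu>] by (simp add: has_bochner_integral_iff)
    have "has_bochner_integral Q (\<lambda>K. 1 / ?c * (?Z K)\<^sup>2 + (\<sigma>2 * real R - 2 * a) / ?c * ?Z K + a\<^sup>2 / ?c)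
        (1 / ?c * (?z\<^sup>2 + \<sigma>2 * ?z) + (\<sigma>2 * real R - 2 * a) / ?c * ?z + a\<^sup>2 / ?c)"
      by (intro has_bochner_integral_add has_bochner_integral_mult_right hb1 hb2 hbc)
    also have "(\<lambda>K. 1 / ?c * (?Z K)\<^sup>2 + (\<sigma>2 * real R - 2 * a) / ?c * ?Z K + a\<^sup>2 / ?c) = (\<lambda>K. ?g (?Z K))"
      by (auto simp: fun_eq_iff power2_diff add_divide_distrib diff_divide_distrib algebra_simps)
    also have "1 / ?c * (?z\<^sup>2 + \<sigma>2 * ?z) + (\<sigma>2 * real R - 2 * a) / ?c * ?z + a\<^sup>2 / ?c
        = ((?z - a)\<^sup>2 + \<sigma>2 * ?z * real (Suc R)) / ?c"
      by (simp add: power2_diff add_divide_distrib diff_divide_distrib algebra_simps)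
    finally have hb: "has_bochner_integral Q (\<lambda>K. ?g (?Z K)) (((?z - a)\<^sup>2 + \<sigma>2 * ?z * real (Suc R)) / ?c)" .
    have ind: "(\<lambda>K. indicator {X. ?low (Suc h) R X} (forest (Suc h) s K)) =
        (indicator {K. ?low (Suc h) R (forest (Suc h) s K)} :: _ \<Rightarrow> ennreal)" for s
      by (auto simp: indicator_def)
    have "emeasure Q {K. ?low h (Suc R) (forest h S K)} =
        (\<integral>\<^sup>+K. indicator {K. ?low h (Suc R) (forest h S K)} K \<partial>Q)"
      using sets[OF Suc.prems, of "Suc R"] by simp
    also have "\<dots> = (\<integral>\<^sup>+K. indicator {X. ?low (Suc h) R X} (forest (Suc h) (?L K) K) \<partial>Q)"
      by (intro nn_integral_cong) (simp only: indicator_def mem_Collect_eq low_iff)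
    also have "\<dots> = (\<integral>\<^sup>+K'. \<integral>\<^sup>+K. indicator {X. ?low (Suc h) R X} (forest (Suc h) (?L K') K) \<partial>Q \<partial>Q)"
      by (rule nn_integral_first_step[OF Suc.prems]) (simp only: ind, rule borel_measurable_indicator, rule sets)
    also have "\<dots> \<le> (\<integral>\<^sup>+K'. ennreal (?g (?Z K')) \<partial>Q)"
    proof (rule nn_integral_mono)
      fix K' :: "nat list \<Rightarrow> nat"
      have b: "base (Suc h) (?L K')" by (rule base_level_forest[OF Suc.prems]) simp
      show "(\<integral>\<^sup>+K. indicator {X. ?low (Suc h) R X} (forest (Suc h) (?L K') K) \<partial>Q) \<le> ennreal (?g (?Z K'))"
        unfolding ind using sets[OF b] Suc.IH[OF b] by simp
    qed
    also have "\<dots> = ennreal (((?z - a)\<^sup>2 + \<sigma>2 * ?z * real (Suc R)) / ?c)"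
      using hb \<sigma>2 c
      by (subst nn_integral_eq_integral) (auto simp: has_bochner_integral_iff intro!: divide_nonneg_pos add_nonneg_nonneg)
    finally show ?thesis .
  qed
qed

text \<open>The preceding bound with \<open>a\<close> the initial size, \<open>\<theta>\<close> half
  of it and \<open>R = 2 * H\<close> equals \<open>8 * \<sigma>2 / A\<close>. This fixes how large
  \<open>A\<close> must be.\<close>

lemma prob_level_low_half:
  assumes "base h S" "card S = A * H" "0 < A * H" "32 * \<sigma>2 \<le> real A"
  shows "measure Q {K. \<exists>t\<le>2 * H. real (card (level (h + t) (forest h S K))) < real (card S) / 2} \<le> 1 / 4"
proof -
  let ?n = "real (card S)"
  have n: "?n = real A * real H" "0 < real A" "0 < real H" using assms by auto
  have "emeasure Q {K. \<exists>t\<le>2 * H. real (card (level (h + t) (forest h S K))) < ?n / 2}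
    \<le> ennreal (((?n - ?n)\<^sup>2 + \<sigma>2 * ?n * real (2 * H)) / (?n - ?n / 2)\<^sup>2)"
    using n by (intro prob_level_low assms(1)) simp
  also have "((?n - ?n)\<^sup>2 + \<sigma>2 * ?n * real (2 * H)) / (?n - ?n / 2)\<^sup>2 = 8 * \<sigma>2 / real A"
    using n by (simp add: power2_eq_square field_simps)
  finally have "measure Q {K. \<exists>t\<le>2 * H. real (card (level (h + t) (forest h S K))) < ?n / 2} \<le> 8 * \<sigma>2 / real A"
    using \<sigma>2 by (simp add: offspring_field.P.emeasure_eq_measure)
  also have "\<dots> \<le> 1 / 4" using assms(4) n by (simp add: field_simps)
  finally show ?thesis .
qed

section \<open>Passing from one scale to the next\<close>

definition good_scale :: "nat \<Rightarrow> nat \<Rightarrow> nat \<Rightarrow> bool" where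
  "good_scale A H l \<longleftrightarrow> (\<forall>h S. base h S \<longrightarrow> card S = A * H \<longrightarrow>
     measure Q {K. \<not> wide (forest h S K) h (h + 2 * H) l} \<le> 1 / 2)"

lemma level_forest_nonempty_if_not_low:
  assumes "\<not> (\<exists>t\<le>R. real (card (level (h + t) (forest h S K))) < \<theta>)" "0 < \<theta>" "t \<in> {h..h + R}"
  shows "\<exists>u\<in>forest h S K. length u = t"
proof -
  have "t - h \<le> R" "h + (t - h) = t" using assms(3) by auto
  then have "real (card (level t (forest h S K))) > 0" using assms(1,2) by (metis not_less order_less_le_trans)
  then have "level t (forest h S K) \<noteq> {}" by auto
  then show ?thesis by (auto simp: level_def)
qed

text \<open>For cost 1 a constant potential works, so the only way to fail is an empty
  level.\<close>

lemma good_scale_1: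
  assumes "0 < A * H" "32 * \<sigma>2 \<le> real A"
  shows "good_scale A H 1"
  unfolding good_scale_def
proof (intro allI impI)
  fix h S assume S: "base h S" "card S = A * H"
  let ?low = "{K. \<exists>t\<le>2 * H. real (card (level (h + t) (forest h S K))) < real (card S) / 2}"
  have "measure Q {K. \<not> wide (forest h S K) h (h + 2 * H) 1} \<le> measure Q ?low"
  proof (rule offspring_field.P.finite_measure_mono)
    show "?low \<in> sets Q" by (rule sets_level_low[OF S(1)])
    show "{K. \<not> wide (forest h S K) h (h + 2 * H) 1} \<subseteq> ?low"
    proof (rule subsetI, rule ccontr)
      fix K assume "K \<in> {K. \<not> wide (forest h S K) h (h + 2 * H) 1}" "K \<notin> ?low"
      moreover have "wide (forest h S K) h (h + 2 * H) 1"
        using \<open>K \<notin> ?low\<close> assms(1) S(2) level_forest_nonempty_if_not_low[of "2 * H" h S K "real (card S) / 2"]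
        by (intro wide_1 ballI) simp
      ultimately show False by simp
    qed
  qed
  also have "\<dots> \<le> 1 / 4" by (rule prob_level_low_half[OF S assms])
  finally show "measure Q {K. \<not> wide (forest h S K) h (h + 2 * H) 1} \<le> 1 / 2" by simp
qed

text \<open>A union bound over fewer than \<open>32 * q\<close> layers, each with at least
  \<open>8 * q\<close> blocks of which \<open>q\<close> must be wide. Each unit of \<open>q\<close>
  contributes the factor \<open>2 * (3 / 4) ^ 8\<close>, about \<open>0.2\<close>, and
  \<open>q = 4\<close> is the first value from which the bound \<open>1 / 4\<close> holds.\<close>

lemma layer_failure_bound:
  fixes q :: nat
  assumes "4 \<le> q"
  shows "32 * real q * (2 ^ q * (3 / 4) ^ (8 * q)) \<le> 1 / 4"
proof -
  have e: "2 ^ q * (3 / 4) ^ (8 * q) = (6561 / 32768 :: real) ^ q" for q :: nat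
  proof -
    have "2 ^ q * (3 / 4) ^ (8 * q) = (2 * (3 / 4) ^ 8 :: real) ^ q"
      by (simp only: power_mult power_mult_distrib)
    also have "2 * (3 / 4) ^ 8 = (6561 / 32768 :: real)" by (simp add: power_divide)
    finally show ?thesis .
  qed
  have "32 * real q * (6561 / 32768 :: real) ^ q \<le> 1 / 4"
    using assms
  proof (induction q rule: dec_induct)
    case base
    show ?case by (simp add: field_simps)
  next
    case (step n)
    have "real (Suc n) * (6561 / 32768) \<le> real n" using step by simp
    then have "32 * (real (Suc n) * (6561 / 32768)) * (6561 / 32768 :: real) ^ n \<le> 32 * real n * (6561 / 32768 :: real) ^ n"
      by (intro mult_right_mono) auto
    then have "32 * real (Suc n) * (6561 / 32768 :: real) ^ Suc n \<le> 32 * real n * (6561 / 32768 :: real) ^ n"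
      by (simp only: power_Suc mult_ac)
    then show ?case using step.IH by linarith
  qed
  then show ?thesis by (simp add: e)
qed

text \<open>A path with fewer than \<open>H / 2\<close> steps stays in one of the \<open>32 * q\<close> overlapping layers of height \<open>2 * H\<close>,
  each of which contains at least \<open>8 * q\<close> blocks of the smaller scale.\<close>

lemma good_scale_step:
  assumes "good_scale A H l" "4 \<le> q" "0 < A * H" "32 * \<sigma>2 \<le> real A"
  shows "good_scale A (16 * q * H) (min (q * l) (H div 2))"
  unfolding good_scale_def
proof (intro allI impI)
  fix h S assume S: "base h S" "card S = A * (16 * q * H)"
  let ?H = "16 * q * H" and ?l = "min (q * l) (H div 2)"
  let ?low = "{K. \<exists>t\<le>2 * ?H. real (card (level (h + t) (forest h S K))) < real (card S) / 2}"
  let ?\<epsilon> = "2 ^ q * (3 / 4) ^ (8 * q) :: real"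
  \<comment> \<open>The size of the level is made part of the bad event. Its probability is then
    small for every base, small ones included, as averaging over the random level requires.\<close>
  define P where "P k s X \<longleftrightarrow> 8 * q * (A * H) \<le> card s \<and> \<not> wide X (h + k * H) (h + k * H + 2 * H) (q * l)"
    for k and s X :: "nat list set"
  define bad where "bad k = {K. P k (level (h + k * H) (forest h S K))
    (forest (h + k * H) (level (h + k * H) (forest h S K)) K)}" for k
  have pred: "Measurable.pred Q (\<lambda>K. P k s (forest (h + k * H) s K))" if "base (h + k * H) s" for k s
  proof -
    have "Measurable.pred Q (\<lambda>K. \<not> wide (forest (h + k * H) s K) (h + k * H) (h + k * H + 2 * H) (q * l))"
      by (intro pred_intros_logic(2) pred_wide_forest that)
    then show ?thesis unfolding P_def by (cases "8 * q * (A * H) \<le> card s") simp_all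
  qed
  have bad_sets: "bad k \<in> sets Q" for k
    unfolding bad_def using pred_compose_level_forest[where t = "h + k * H" and P = "P k", OF S(1) _ pred]
    by (simp add: pred_def)
  have bad: "measure Q (bad k) \<le> ?\<epsilon>" for k
    unfolding bad_def
  proof (rule prob_branching_le[OF S(1)])
    fix s assume s: "base (h + k * H) s"
    show "measure Q {K. P k s (forest (h + k * H) s K)} \<le> ?\<epsilon>"
    proof (cases "8 * q * (A * H) \<le> card s")
      case True
      then show ?thesis
        unfolding P_def using assms(1) s
        by (simp add: prob_not_wide_blocks[where n = "A * H" and H = "2 * H"] good_scale_def)
    qed (simp add: P_def)
  qed (use pred in auto)
  have sub: "{K. \<not> wide (forest h S K) h (h + 2 * ?H) ?l} \<subseteq> ?low \<union> (\<Union>k\<le>32 * q - 2. bad k)"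
  proof (rule subsetI, rule ccontr)
    fix K assume K: "K \<in> {K. \<not> wide (forest h S K) h (h + 2 * ?H) ?l}"
      and n: "K \<notin> ?low \<union> (\<Union>k\<le>32 * q - 2. bad k)"
    \<comment> \<open>The new strip has height \<open>2 * (16 * q * H) = 32 * q * H\<close>, hence
      \<open>m = 32 * q\<close> and layers indexed by \<open>k\<close> up to
      \<open>32 * q - 2\<close>.\<close>
    have "wide (forest h S K) h (h + (32 * q) * H) ?l"
    proof (rule wide_layers)
      fix t
      have "finite (level t (forest h S K))"
      proof (cases "h \<le> t")
        case True
        then show ?thesis using base_level_forest[OF S(1) True, of K] by (simp add: base_def)
      next
        case False
        then have "level t (forest h S K) = {}" by (auto simp: level_def forest_def)
        then show ?thesis by simp
      qed
      then show "finite {u \<in> forest h S K. length u = t}" by (simp add: level_def)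
    next
      fix k assume k: "k \<le> 32 * q - 2"
      let ?L = "level (h + k * H) (forest h S K)"
      have "k * H \<le> 32 * q * H" using k by (intro mult_right_mono) auto
      then have "k * H \<le> 2 * ?H" by simp
      then have "real (card S) / 2 \<le> real (card ?L)" using n unfolding Un_iff mem_Collect_eq not_less[symmetric] by blast
      \<comment> \<open>The base holds \<open>16 * q\<close> blocks of size \<open>A * H\<close>; a
        level at least half as large still holds \<open>8 * q\<close> of them.\<close>
      then have "card S \<le> 2 * card ?L" by linarith
      then have "8 * q * (A * H) \<le> card ?L" using S(2) by (simp add: algebra_simps)
      then have "wide (forest (h + k * H) ?L K) (h + k * H) (h + k * H + 2 * H) (q * l)"
        using n k by (auto simp: bad_def P_def)
      then have "wide (forest h S K) (h + k * H) (h + k * H + 2 * H) (q * l)"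
        by (subst wide_forest_above) auto
      then have "wide (forest h S K) (h + k * H) (h + k * H + 2 * H) ?l"
        by (rule wide_mono) simp
      moreover have "h + k * H + 2 * H = h + (k + 2) * H" by (simp add: algebra_simps)
      ultimately show "wide (forest h S K) (h + k * H) (h + (k + 2) * H) ?l" by (simp only:)
    qed (use assms in auto)
    then show False using K by (simp add: mult.assoc)
  qed
  have low: "?low \<in> sets Q" by (rule sets_level_low[OF S(1)])
  have "measure Q {K. \<not> wide (forest h S K) h (h + 2 * ?H) ?l} \<le> measure Q (?low \<union> (\<Union>k\<le>32 * q - 2. bad k))"
    using low bad_sets by (intro offspring_field.P.finite_measure_mono sub) auto
  also have "\<dots> \<le> measure Q ?low + measure Q (\<Union>k\<le>32 * q - 2. bad k)"
    using low bad_sets by (intro measure_Un_le) auto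
  also have "measure Q (\<Union>k\<le>32 * q - 2. bad k) \<le> (\<Sum>k\<le>32 * q - 2. measure Q (bad k))"
    using bad_sets by (intro offspring_field.P.finite_measure_subadditive_finite) auto
  also have "(\<Sum>k\<le>32 * q - 2. measure Q (bad k)) \<le> (\<Sum>k\<le>32 * q - 2. ?\<epsilon>)"
    by (intro sum_mono bad)
  also have "\<dots> = real (32 * q - 1) * ?\<epsilon>" using assms(2) by (simp add: Suc_diff_le)
  also have "\<dots> \<le> 32 * real q * ?\<epsilon>" by (intro mult_right_mono) auto
  also have "\<dots> \<le> 1 / 4" by (rule layer_failure_bound[OF assms(2)])
  also have "measure Q ?low \<le> 1 / 4"
    using assms S by (intro prob_level_low_half[where A = A]) auto
  finally show "measure Q {K. \<not> wide (forest h S K) h (h + 2 * ?H) ?l} \<le> 1 / 2" by simp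
qed

text \<open>Starting at \<open>2 * q\<close> rather than at 1 makes half of the current scale equal
  to \<open>q * (16 * q) ^ j\<close>, which is at least \<open>q ^ Suc j\<close>; the minimum in the
  step therefore never cuts the cost.\<close>

lemma good_scale_iterate:
  assumes "4 \<le> q" "0 < A" "32 * \<sigma>2 \<le> real A"
  shows "good_scale A (2 * q * (16 * q) ^ j) (q ^ j)"
proof (induction j)
  case 0
  show ?case using good_scale_1[of A "2 * q"] assms by simp
next
  case (Suc j)
  let ?H = "2 * q * (16 * q) ^ j"
  have "q ^ Suc j \<le> q * (16 * q) ^ j" by (simp add: power_mult_distrib)
  also have "\<dots> = ?H div 2" by simp
  finally have "min (q * q ^ j) (?H div 2) = q ^ Suc j" by simp
  with good_scale_step[OF Suc assms(1) _ assms(3)] assms show ?case by (simp add: mult_ac)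
qed

end

section \<open>The conditioned tree\<close>

text \<open>Quantifying over the cut yields a property of the tree alone, and in fact of its
  truncation at height \<open>b\<close>, which is what the law of the conditioned tree can be
  applied to.\<close>

definition split_wide :: "nat list set \<Rightarrow> nat \<Rightarrow> nat \<Rightarrow> nat \<Rightarrow> bool" where
  "split_wide \<tau> h b l \<longleftrightarrow> (\<exists>S1 S2. level h \<tau> = S1 \<union> S2 \<and> (\<forall>u\<in>S1. \<forall>v\<in>S2. u \<lhd> v) \<and>
     wide (descendants \<tau> S1 h) h b l \<and> wide (descendants \<tau> S2 h) h b l)"

lemma split_wide_cong:
  assumes "h \<le> b" "\<And>u. length u \<in> {h..b} \<Longrightarrow> u \<in> X \<longleftrightarrow> u \<in> Y"
  shows "split_wide X h b l \<longleftrightarrow> split_wide Y h b l"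
proof -
  have "level h X = level h Y" using assms by (auto simp: level_def)
  moreover have "wide (descendants X S h) h b l \<longleftrightarrow> wide (descendants Y S h) h b l" for S
    by (rule wide_cong) (use assms(2) in \<open>auto simp: descendants_def\<close>)
  ultimately show ?thesis unfolding split_wide_def by simp
qed

lemma descendants_forest:
  assumes "S1 \<subseteq> S"
  shows "descendants (forest h S K) S1 h = forest h S1 K"
  using assms by (auto simp: descendants_def forest_def)

lemma pred_split_wide:
  assumes "base h S" "h \<le> b"
  shows "Measurable.pred (offspring_field \<mu>)
    (\<lambda>K. n \<le> card (level h (forest h S K)) \<and> \<not> split_wide (forest h S K) h b l)"
proof (rule measurable_forest_truncated[OF assms(1)])
  fix K
  let ?X = "forest h S K"
  have "level h ?X = level h (truncate_tree b ?X)" using assms(2) by (auto simp: level_def truncate_tree_def)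
  moreover have "split_wide ?X h b l \<longleftrightarrow> split_wide (truncate_tree b ?X) h b l"
    by (rule split_wide_cong[OF assms(2)]) (auto simp: truncate_tree_def)
  ultimately show "(n \<le> card (level h ?X) \<and> \<not> split_wide ?X h b l) =
      (n \<le> card (level h (truncate_tree b ?X)) \<and> \<not> split_wide (truncate_tree b ?X) h b l)" by simp
qed auto

lemma measurable_truncate_tree:
  "truncate_tree n \<in> tree_space \<rightarrow>\<^sub>M count_space {s. finite s}"
proof -
  have countable: "countable {s::nat list set. finite s}" by (rule countable_Collect_finite)
  let ?G = "{{\<tau>. plane_tree \<tau> \<and> locally_finite \<tau> \<and> truncate_tree n \<tau> = s} | n s. True}"
  have G: "?G \<subseteq> Pow {\<tau>. plane_tree \<tau> \<and> locally_finite \<tau>}" by auto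
  have space: "space tree_space = {\<tau>. plane_tree \<tau> \<and> locally_finite \<tau>}"
    unfolding tree_space_def using G by (rule space_measure_of)
  have "truncate_tree n -` {s} \<inter> space tree_space \<in> sets tree_space" for s
  proof -
    have "truncate_tree n -` {s} \<inter> space tree_space = {\<tau>. plane_tree \<tau> \<and> locally_finite \<tau> \<and> truncate_tree n \<tau> = s}"
      by (auto simp: space)
    also have "\<dots> \<in> sets tree_space"
      unfolding tree_space_def sets_measure_of[OF G] by (rule sigma_sets.Basic) blast
    finally show ?thesis .
  qed
  moreover have "finite (truncate_tree n \<tau>)" if "\<tau> \<in> space tree_space" for \<tau>
    using that finite_level[of \<tau>] by (simp add: truncate_tree_eq_levels space)
  ultimately show ?thesis
    unfolding measurable_count_space_eq_countable[OF countable] by auto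
qed

lemma level_truncate_tree: "t \<le> n \<Longrightarrow> level t (truncate_tree n \<tau>) = level t \<tau>"
  by (auto simp: level_def truncate_tree_def)

lemma split_wide_truncate_tree: "h \<le> b \<Longrightarrow> split_wide (truncate_tree b \<tau>) h b l = split_wide \<tau> h b l"
  by (rule split_wide_cong) (auto simp: truncate_tree_def)

section \<open>Transfer to the conditioned law and its level sizes\<close>

locale surviving_tree = critical_offspring \<mu> \<sigma>2 \<kappa> + prob_space M
  for \<mu> \<sigma>2 \<kappa> and M :: "'a measure" +
  fixes T :: "'a \<Rightarrow> nat list set"
  assumes surviving: "GW_surviving \<mu> M T"
begin

abbreviation "GW \<equiv> offspring_tree"

lemma nn_integral_surviving:
  "(\<integral>\<^sup>+ \<omega>. F (truncate_tree n (T \<omega>)) \<partial>M) =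
   (\<integral>\<^sup>+ K. F (truncate_tree n (GW K)) * of_nat (card (level n (GW K))) \<partial>Q)"
proof -
  have "(\<integral>\<^sup>+ \<omega>. F (truncate_tree n (T \<omega>)) \<partial>M) =
    (\<integral>\<^sup>+ \<tau>. F (truncate_tree n \<tau>) * of_nat (card (level n \<tau>)) \<partial>GW_law \<mu>)"
    using surviving by (simp add: GW_surviving_def)
  \<comment> \<open>The density is rewritten as a function of the truncation. The whole integrand
    then depends on a countable-valued map and is measurable for every \<open>F\<close>.\<close>
  also have "\<dots> = (\<integral>\<^sup>+ \<tau>. F (truncate_tree n \<tau>) * of_nat (card (level n (truncate_tree n \<tau>))) \<partial>GW_law \<mu>)"
    by (simp add: level_truncate_tree)
  also have "\<dots> = (\<integral>\<^sup>+ K. F (truncate_tree n (GW K)) * of_nat (card (level n (truncate_tree n (GW K)))) \<partial>Q)"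
    unfolding GW_law_def
    by (rule nn_integral_distr[OF measurable_offspring_tree])
      (simp only: measurable_distr_eq1,
        rule measurable_compose[OF measurable_truncate_tree, of "\<lambda>s. F s * of_nat (card (level n s))"], simp)
  finally show ?thesis by (simp add: level_truncate_tree)
qed

lemma measurable_surviving:
  "(\<lambda>\<omega>. truncate_tree n (T \<omega>)) \<in> M \<rightarrow>\<^sub>M count_space {s. finite s}"
  using surviving unfolding GW_surviving_def
  by (intro measurable_compose[OF _ measurable_truncate_tree]) auto

lemma sets_surviving: "{\<omega> \<in> space M. P (truncate_tree n (T \<omega>))} \<in> sets M"
proof -
  have "Measurable.pred M (\<lambda>\<omega>. P (truncate_tree n (T \<omega>)))"
    by (rule measurable_compose[OF measurable_surviving]) simp
  then show ?thesis by (simp add: pred_def)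
qed

lemma emeasure_surviving:
  "emeasure M {\<omega> \<in> space M. P (truncate_tree n (T \<omega>))} =
   (\<integral>\<^sup>+ K. indicator {s. P s} (truncate_tree n (GW K)) * of_nat (card (level n (GW K))) \<partial>Q)"
proof -
  have "emeasure M {\<omega> \<in> space M. P (truncate_tree n (T \<omega>))} =
      (\<integral>\<^sup>+ \<omega>. indicator {\<omega> \<in> space M. P (truncate_tree n (T \<omega>))} \<omega> \<partial>M)"
    using sets_surviving[of P n] by simp
  also have "\<dots> = (\<integral>\<^sup>+ \<omega>. indicator {s. P s} (truncate_tree n (T \<omega>)) \<partial>M)"
    by (intro nn_integral_cong) (simp add: indicator_def)
  finally show ?thesis by (simp only: nn_integral_surviving)
qed

lemma sets_GW: "{K. P (truncate_tree n (GW K))} \<in> sets Q"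
proof -
  have "Measurable.pred Q (\<lambda>K. P (truncate_tree n (GW K)))"
    unfolding offspring_tree_eq_forest
    by (rule measurable_compose[OF measurable_truncate_forest[OF base_root]]) simp
  then show ?thesis by (simp add: pred_def)
qed

lemma prob_GW_survives: "emeasure Q {K. level h (GW K) \<noteq> {}} \<le> ennreal (1 / (1 + \<kappa> * real h))"
proof -
  let ?q = "1 / (1 + \<kappa> * real h)"
  have q: "0 \<le> ?q" using \<kappa> by simp
  have sets: "{K. level h (GW K) = {}} \<in> sets Q" "{K. level h (GW K) \<noteq> {}} \<in> sets Q"
    using sets_GW[of "\<lambda>s. level h s = {}" h] sets_GW[of "\<lambda>s. level h s \<noteq> {}" h]
    by (simp_all add: level_truncate_tree)
  have "ennreal (1 - ?q) \<le> emeasure Q {K. level h (GW K) = {}}"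
    using prob_extinct_ge[OF base_root, of h] by (simp add: offspring_tree_eq_forest)
  then have "1 - ?q \<le> measure Q {K. level h (GW K) = {}}"
    using q by (simp add: offspring_field.P.emeasure_eq_measure)
  then have "measure Q {K. level h (GW K) \<noteq> {}} \<le> ?q"
    using offspring_field.P.prob_neg[of \<mu> "\<lambda>K. level h (GW K) = {}"] sets by simp
  then show ?thesis using q by (simp add: offspring_field.P.emeasure_eq_measure ennreal_leI)
qed

text \<open>Under the conditioned law the inverse level size is a supermartingale; the bound is its
  maximal inequality, obtained by summing over the first level of size at most \<open>\<theta>\<close>.\<close>

lemma prob_level_small:
  assumes "0 \<le> \<theta>"
  shows "emeasure M {\<omega> \<in> space M. \<exists>h\<ge>h0. real (card (level h (T \<omega>))) \<le> \<theta>}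
    \<le> ennreal (\<theta> / (1 + \<kappa> * real h0))"
proof -
  \<comment> \<open>The event that \<open>h\<close> is the first level from \<open>h0\<close> on
    with size at most \<open>\<theta>\<close>; it depends only on the truncation at
    \<open>h\<close>.\<close>
  define first where "first h s \<longleftrightarrow> real (card (level h s)) \<le> \<theta> \<and>
    (\<forall>h'\<in>{h0..<h}. \<theta> < real (card (level h' s)))" for h and s :: "nat list set"
  have first_trunc: "first h (truncate_tree h \<tau>) = first h \<tau>" for h \<tau>
    by (auto simp: first_def level_truncate_tree)
  define E where "E h = {\<omega> \<in> space M. first (h0 + h) (truncate_tree (h0 + h) (T \<omega>))}" for h
  \<comment> \<open>The unconditioned counterparts of \<open>E h\<close>. They are disjoint and
    imply survival up to \<open>h0\<close>, and on them the density is at most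
    \<open>\<theta>\<close>; their probabilities thus sum to at most that of survival.\<close>
  define D where "D h = {K. first (h0 + h) (GW K) \<and> level (h0 + h) (GW K) \<noteq> {}}" for h
  have D_sets: "D h \<in> sets Q" for h
    using sets_GW[of "\<lambda>s. first (h0 + h) s \<and> level (h0 + h) s \<noteq> {}" "h0 + h"]
    by (simp add: D_def first_trunc level_truncate_tree)
  have E_sets: "E h \<in> sets M" for h unfolding E_def by (rule sets_surviving)
  have "{\<omega> \<in> space M. \<exists>h\<ge>h0. real (card (level h (T \<omega>))) \<le> \<theta>} \<subseteq> (\<Union>h. E h)"
  proof
    fix \<omega> assume "\<omega> \<in> {\<omega> \<in> space M. \<exists>h\<ge>h0. real (card (level h (T \<omega>))) \<le> \<theta>}"
    then have \<omega>: "\<omega> \<in> space M" and ex: "\<exists>k. real (card (level (h0 + k) (T \<omega>))) \<le> \<theta>"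
      by (auto simp: le_iff_add)
    define k where "k = (LEAST k. real (card (level (h0 + k) (T \<omega>))) \<le> \<theta>)"
    have "real (card (level (h0 + k) (T \<omega>))) \<le> \<theta>" unfolding k_def using ex by (rule LeastI_ex)
    moreover have "\<theta> < real (card (level h' (T \<omega>)))" if "h' \<in> {h0..<h0 + k}" for h'
    proof -
      have "h' - h0 < k" "h0 + (h' - h0) = h'" using that by auto
      then show ?thesis using not_less_Least[of "h' - h0"] unfolding k_def by fastforce
    qed
    ultimately have "\<omega> \<in> E k" using \<omega> unfolding E_def first_trunc by (simp add: first_def)
    then show "\<omega> \<in> (\<Union>h. E h)" by blast
  qed
  then have "emeasure M {\<omega> \<in> space M. \<exists>h\<ge>h0. real (card (level h (T \<omega>))) \<le> \<theta>} \<le> emeasure M (\<Union>h. E h)"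
    using E_sets by (intro emeasure_mono) auto
  also have "\<dots> \<le> (\<Sum>h. emeasure M (E h))"
    using E_sets by (intro emeasure_subadditive_countably) auto
  also have "\<dots> \<le> (\<Sum>h. ennreal \<theta> * emeasure Q (D h))"
  proof (rule suminf_le)
    fix h
    have "emeasure M (E h) =
        (\<integral>\<^sup>+ K. indicator {s. first (h0 + h) s} (truncate_tree (h0 + h) (GW K)) * of_nat (card (level (h0 + h) (GW K))) \<partial>Q)"
      unfolding E_def by (rule emeasure_surviving)
    also have "\<dots> \<le> (\<integral>\<^sup>+ K. ennreal \<theta> * indicator (D h) K \<partial>Q)"
    proof (rule nn_integral_mono)
      fix K
      show "indicator {s. first (h0 + h) s} (truncate_tree (h0 + h) (GW K)) * of_nat (card (level (h0 + h) (GW K)))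
        \<le> ennreal \<theta> * indicator (D h) K"
      proof (cases "K \<in> D h")
        case True
        then have "real (card (level (h0 + h) (GW K))) \<le> \<theta>" by (simp add: D_def first_def)
        then have "of_nat (card (level (h0 + h) (GW K))) \<le> ennreal \<theta>"
          by (metis ennreal_leI ennreal_of_nat_eq_real_of_nat)
        then show ?thesis using True by (simp add: D_def first_trunc)
      next
        \<comment> \<open>Outside \<open>D h\<close> the indicator vanishes, or the level is empty
          and the density vanishes.\<close>
        case False
        then show ?thesis by (auto simp: D_def first_trunc indicator_def)
      qed
    qed
    also have "\<dots> = ennreal \<theta> * emeasure Q (D h)" using D_sets by (simp add: nn_integral_cmult)
    finally show "emeasure M (E h) \<le> ennreal \<theta> * emeasure Q (D h)" .
  qed auto
  also have "\<dots> = ennreal \<theta> * (\<Sum>h. emeasure Q (D h))" by simp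
  also have "(\<Sum>h. emeasure Q (D h)) = emeasure Q (\<Union>h. D h)"
  proof (rule suminf_emeasure)
    show "disjoint_family D"
      unfolding disjoint_family_on_def
    proof (intro ballI impI)
      have "D m \<inter> D n = {}" if "m < n" for m n
      proof (rule equals0I)
        fix K assume "K \<in> D m \<inter> D n"
        then have "first (h0 + m) (GW K)" "first (h0 + n) (GW K)" by (auto simp: D_def)
        moreover have "h0 + m \<in> {h0..<h0 + n}" using that by simp
        ultimately show False unfolding first_def by fastforce
      qed
      then show "D m \<inter> D n = {}" if "m \<noteq> n" for m n
        using that by (metis Int_commute linorder_neq_iff)
    qed
  qed (use D_sets in auto)
  also have "emeasure Q (\<Union>h. D h) \<le> emeasure Q {K. level h0 (GW K) \<noteq> {}}"
  proof (rule emeasure_mono)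
    have "level h0 (GW K) \<noteq> {}" if "level (h0 + h) (GW K) \<noteq> {}" for h K
      using that
    proof (induction h)
      case (Suc h)
      then show ?case by (auto simp: offspring_tree_eq_forest level_forest_Suc)
    qed simp
    then show "(\<Union>h. D h) \<subseteq> {K. level h0 (GW K) \<noteq> {}}" by (auto simp: D_def)
    show "{K. level h0 (GW K) \<noteq> {}} \<in> sets Q"
      using sets_GW[of "\<lambda>s. level h0 s \<noteq> {}" h0] by (simp add: level_truncate_tree)
  qed
  also have "\<dots> \<le> ennreal (1 / (1 + \<kappa> * real h0))" by (rule prob_GW_survives)
  also have "ennreal \<theta> * ennreal (1 / (1 + \<kappa> * real h0)) = ennreal (\<theta> / (1 + \<kappa> * real h0))"
    using assms \<kappa> by (simp flip: ennreal_mult)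
  finally show ?thesis by (simp add: mult_left_mono)
qed

lemma nn_integral_GW_level_square:
  "(\<integral>\<^sup>+ K. ennreal ((real (card (level n (GW K))))\<^sup>2) \<partial>Q) = ennreal (1 + \<sigma>2 * real n)"
  using nn_integral_level_square[OF base_root, of n] by (simp add: offspring_tree_eq_forest)

text \<open>Cutting the density \<open>card (level n)\<close> at height \<open>c\<close>.\<close>

lemma prob_surviving_le:
  assumes "0 < c" "measure Q {K. P (truncate_tree n (GW K))} \<le> \<epsilon>"
  shows "measure M {\<omega> \<in> space M. P (truncate_tree n (T \<omega>))} \<le> c * \<epsilon> + (1 + \<sigma>2 * real n) / c"
proof -
  let ?B = "{K. P (truncate_tree n (GW K))}" and ?Z = "\<lambda>K. real (card (level n (GW K)))"
  have \<epsilon>: "0 \<le> \<epsilon>" using assms(2) measure_nonneg order_trans by blast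
  have meas: "(\<lambda>K. ennreal ((?Z K)\<^sup>2)) \<in> borel_measurable Q"
    unfolding offspring_tree_eq_forest
    by (rule measurable_compose[OF measurable_card_level_forest[OF base_root]]) simp
  have "emeasure M {\<omega> \<in> space M. P (truncate_tree n (T \<omega>))} =
      (\<integral>\<^sup>+ K. indicator {s. P s} (truncate_tree n (GW K)) * of_nat (card (level n (GW K))) \<partial>Q)"
    by (rule emeasure_surviving)
  also have "\<dots> \<le> (\<integral>\<^sup>+ K. ennreal c * indicator ?B K + ennreal (1 / c) * ennreal ((?Z K)\<^sup>2) \<partial>Q)"
  proof (rule nn_integral_mono)
    fix K
    \<comment> \<open>Values above \<open>c\<close> are at most their square divided by
      \<open>c\<close>, so the part of the density above the cut is paid for by the second
      moment.\<close>
    have "?Z K \<le> c + 1 / c * (?Z K)\<^sup>2"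
    proof (cases "?Z K \<le> c")
      case False
      then have "?Z K * c \<le> ?Z K * ?Z K" by (intro mult_left_mono) auto
      then have "?Z K \<le> 1 / c * (?Z K)\<^sup>2" using assms(1) by (simp add: field_simps power2_eq_square)
      then show ?thesis using assms(1) by linarith
    qed (use assms(1) in \<open>simp add: add_increasing2\<close>)
    then have "ennreal (?Z K) \<le> ennreal (c + 1 / c * (?Z K)\<^sup>2)" by (rule ennreal_leI)
    moreover have "0 \<le> c" "0 \<le> 1 / c" "0 \<le> 1 / c * (?Z K)\<^sup>2" using assms(1) by auto
    ultimately have "ennreal (?Z K) \<le> ennreal c + ennreal (1 / c) * ennreal ((?Z K)\<^sup>2)"
      by (simp only: ennreal_plus ennreal_mult zero_le_power2)
    then show "indicator {s. P s} (truncate_tree n (GW K)) * of_nat (card (level n (GW K)))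
        \<le> ennreal c * indicator ?B K + ennreal (1 / c) * ennreal ((?Z K)\<^sup>2)"
      by (simp add: indicator_def ennreal_of_nat_eq_real_of_nat)
  qed
  also have "\<dots> = ennreal c * emeasure Q ?B + ennreal (1 / c) * ennreal (1 + \<sigma>2 * real n)"
    using sets_GW[of P n] meas
    by (subst nn_integral_add) (simp_all add: nn_integral_cmult nn_integral_GW_level_square)
  also have "\<dots> \<le> ennreal c * ennreal \<epsilon> + ennreal (1 / c) * ennreal (1 + \<sigma>2 * real n)"
    using assms(2) by (intro add_right_mono mult_left_mono)
      (auto simp: offspring_field.P.emeasure_eq_measure ennreal_leI)
  also have "\<dots> = ennreal (c * \<epsilon> + (1 + \<sigma>2 * real n) / c)"
    using assms(1) \<epsilon> \<sigma>2 by (simp flip: ennreal_mult ennreal_plus)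
  finally have "emeasure M {\<omega> \<in> space M. P (truncate_tree n (T \<omega>))} \<le> ennreal (c * \<epsilon> + (1 + \<sigma>2 * real n) / c)" .
  moreover have "0 \<le> c * \<epsilon> + (1 + \<sigma>2 * real n) / c" using assms(1) \<epsilon> \<sigma>2 by simp
  ultimately show ?thesis by (simp only: emeasure_eq_measure ennreal_le_iff)
qed

text \<open>The base is cut into two parts with at least \<open>B\<close> blocks each, and a single
  wide block makes a part wide. The block bound with \<open>b = 1\<close> gives failure probability
  at most \<open>2 * (3 / 4) ^ B\<close> per part.\<close>

lemma prob_not_split_wide_forest:
  assumes "good_scale A H l" "base h S" "2 * (B * (A * H)) \<le> card S"
  shows "measure Q {K. \<not> split_wide (forest h S K) h (h + 2 * H) l} \<le> 4 * (3 / 4) ^ B"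
proof -
  let ?n = "B * (A * H)" and ?b = "h + 2 * H"
  have "finite S" "\<And>u. u \<in> S \<Longrightarrow> length u = h" "?n \<le> card S" using assms by (auto simp: base_def)
  then obtain S1 S2 where S: "S = S1 \<union> S2" "S1 \<inter> S2 = {}" "card S1 = ?n" "card S2 = card S - ?n"
      "\<And>u v. u \<in> S1 \<Longrightarrow> v \<in> S2 \<Longrightarrow> u \<lhd> v"
    using split_rightmost[of S h ?n] by blast
  have bs: "base h S1" "base h S2" using assms(2) S(1) by (auto simp: base_def)
  have le: "measure Q {K. \<not> wide (forest h S' K) h ?b l} \<le> 2 * (3 / 4) ^ B"
    if "base h S'" "?n \<le> card S'" for S'
    using prob_not_wide_blocks[where n = "A * H" and b = 1 and H = "2 * H" and l = l, OF _ that] assms(1)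
    by (simp add: good_scale_def)
  have sets: "{K. \<not> wide (forest h S' K) h ?b l} \<in> sets Q" if "base h S'" for S'
    using pred_intros_logic(2)[OF pred_wide_forest[OF that]] by (simp add: pred_def)
  have "measure Q {K. \<not> split_wide (forest h S K) h ?b l} \<le>
      measure Q ({K. \<not> wide (forest h S1 K) h ?b l} \<union> {K. \<not> wide (forest h S2 K) h ?b l})"
  proof (rule offspring_field.P.finite_measure_mono)
    show "{K. \<not> split_wide (forest h S K) h ?b l} \<subseteq>
      {K. \<not> wide (forest h S1 K) h ?b l} \<union> {K. \<not> wide (forest h S2 K) h ?b l}"
    proof (rule subsetI, rule ccontr)
      fix K assume K: "K \<in> {K. \<not> split_wide (forest h S K) h ?b l}"
        and n: "K \<notin> {K. \<not> wide (forest h S1 K) h ?b l} \<union> {K. \<not> wide (forest h S2 K) h ?b l}"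
      have "split_wide (forest h S K) h ?b l"
        unfolding split_wide_def level_forest_base[OF assms(2)]
        using S n descendants_forest[of S1 S h K] descendants_forest[of S2 S h K]
        by (intro exI[of _ S1] exI[of _ S2]) simp
      then show False using K by simp
    qed
  qed (use sets bs in auto)
  also have "\<dots> \<le> measure Q {K. \<not> wide (forest h S1 K) h ?b l} + measure Q {K. \<not> wide (forest h S2 K) h ?b l}"
    by (rule measure_Un_le[OF sets sets]) (use bs in auto)
  also have "\<dots> \<le> 2 * (3 / 4) ^ B + 2 * (3 / 4) ^ B"
    using S assms(3) by (intro add_mono le bs) auto
  finally show ?thesis by simp
qed

text \<open>The estimate for fixed bases is carried to the random level \<open>h\<close> by
  branching, and then to the conditioned law by cutting its density at \<open>c\<close>.\<close>

lemma prob_not_split_wide: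
  assumes "good_scale A H l" "0 < c"
  shows "measure M {\<omega> \<in> space M. 2 * (B * (A * H)) \<le> card (level h (T \<omega>)) \<and> \<not> split_wide (T \<omega>) h (h + 2 * H) l}
    \<le> c * (4 * (3 / 4) ^ B) + (1 + \<sigma>2 * real (h + 2 * H)) / c"
proof -
  let ?b = "h + 2 * H"
  define P where "P X \<longleftrightarrow> 2 * (B * (A * H)) \<le> card (level h X) \<and> \<not> split_wide X h ?b l" for X
  have trunc: "P (truncate_tree ?b \<tau>) = P \<tau>" for \<tau>
    by (simp add: P_def level_truncate_tree split_wide_truncate_tree)
  have P_forest: "P (forest h (level h (forest 0 {[]} K)) K) = P (GW K)" for K
  proof -
    let ?X = "forest h (level h (forest 0 {[]} K)) K"
    have X: "?X = {u \<in> GW K. h \<le> length u}"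
      by (simp add: forest_level_forest offspring_tree_eq_forest)
    have "level h ?X = level h (GW K)" unfolding X by (auto simp: level_def)
    moreover have "split_wide ?X h ?b l = split_wide (GW K) h ?b l"
      unfolding X by (rule split_wide_cong) auto
    ultimately show ?thesis by (simp add: P_def)
  qed
  have "measure Q {K. P (forest h (level h (forest 0 {[]} K)) K)} \<le> 4 * (3 / 4) ^ B"
  proof (rule prob_branching_le[where P = "\<lambda>_. P", OF base_root])
    fix s assume s: "base h s"
    show "Measurable.pred Q (\<lambda>K. P (forest h s K))"
      unfolding P_def by (rule pred_split_wide[OF s]) simp
    show "measure Q {K. P (forest h s K)} \<le> 4 * (3 / 4) ^ B"
    proof (cases "2 * (B * (A * H)) \<le> card s")
      case True
      then show ?thesis using prob_not_split_wide_forest[OF assms(1) s True]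
        by (simp add: P_def level_forest_base[OF s])
    qed (simp add: P_def level_forest_base[OF s])
  qed auto
  then have "measure M {\<omega> \<in> space M. P (truncate_tree ?b (T \<omega>))} \<le> c * (4 * (3 / 4) ^ B) + (1 + \<sigma>2 * real ?b) / c"
    by (intro prob_surviving_le[OF assms(2)]) (simp add: trunc P_forest)
  then show ?thesis by (simp add: trunc) (simp add: P_def)
qed

end

section \<open>Choice of scales and almost sure conclusions\<close>

section \<open>The girth\<close>

text \<open>With \<open>x = sqrt (ln r)\<close>, take \<open>q\<close> of order \<open>exp x\<close>
  and the largest \<open>j\<close> for which the scale \<open>2 * q * (16 * q) ^ j\<close> stays
  below \<open>r * exp (- x)\<close>. The factor \<open>exp (- x)\<close> beats the logarithms in
  the number of blocks and in the level size, while \<open>j\<close> is at most \<open>x\<close>, so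
  the factors 16 lost in \<open>j\<close> steps cost only \<open>exp (4 * x)\<close>.\<close>

lemma eventually_scale_parameters:
  fixes A :: nat
  shows "\<forall>\<^sub>F r in sequentially. \<exists>q j. 4 \<le> q \<and> 2 * (2 * q * (16 * q) ^ j) \<le> r \<and>
    real (2 * (nat \<lceil>24 * ln (real r)\<rceil> * (A * (2 * q * (16 * q) ^ j)))) \<le> real r / (4 * (log 2 (real r) + 1)\<^sup>2) \<and>
    real r * exp (- 8 * sqrt (ln (real r))) \<le> real (q ^ j)"
proof -
  have e1: "\<forall>\<^sub>F r in sequentially. 128 \<le> exp (sqrt (ln (real r)))" by real_asymp
  have e2: "\<forall>\<^sub>F r in sequentially. 4 * exp (2 * sqrt (ln (real r))) \<le> real r" by real_asymp
  have "((\<lambda>r. 2 * (24 * ln (real r) + 1) * exp (- sqrt (ln (real r))) * (4 * (log 2 (real r) + 1)\<^sup>2)) \<longlongrightarrow> 0) sequentially"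
    by real_asymp
  then have "((\<lambda>r. real A * (2 * (24 * ln (real r) + 1) * exp (- sqrt (ln (real r))) * (4 * (log 2 (real r) + 1)\<^sup>2))) \<longlongrightarrow> real A * 0) sequentially"
    by (intro tendsto_mult_left)
  then have e3: "\<forall>\<^sub>F r in sequentially. real A * (2 * (24 * ln (real r) + 1) * exp (- sqrt (ln (real r))) * (4 * (log 2 (real r) + 1)\<^sup>2)) < 1"
    by (rule order_tendstoD) simp
  have e4: "\<forall>\<^sub>F r in sequentially. 2 \<le> r" by (rule eventually_ge_at_top)
  show ?thesis
    using e1 e2 e3 e4
  proof eventually_elim
    case (elim r)
    define x where "x = sqrt (ln (real r))"
    have r: "1 < real r" using elim by simp
    then have lnr: "0 < ln (real r)" by simp
    have x: "0 < x" "x * x = ln (real r)" using lnr by (simp_all add: x_def)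
    have exx: "exp (x * x) = real r" using x(2) r by simp
    define q where "q = nat \<lceil>exp x\<rceil>"
    have q1: "exp x \<le> real q" unfolding q_def by linarith
    have q2: "real q \<le> 2 * exp x" using elim(1) unfolding q_def x_def[symmetric] by linarith
    have q4: "4 \<le> q" using q1 elim(1) unfolding x_def[symmetric] by linarith
    \<comment> \<open>The largest real value allowed for \<open>(16 * q) ^ j\<close> if the scale is
      not to exceed \<open>r * exp (- x)\<close>.\<close>
    define y where "y = real r * exp (- x) / (2 * real q)"
    have "4 * exp (2 * x) \<le> real r" using elim(2) by (simp add: x_def)
    then have "4 * exp (2 * x) * exp (- x) \<le> real r * exp (- x)" by (intro mult_right_mono) auto
    then have "4 * exp x \<le> real r * exp (- x)" by (simp add: mult.assoc flip: exp_add)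
    then have "2 * real q \<le> real r * exp (- x)" using q2 by linarith
    then have y1: "1 \<le> y" using q4 by (simp add: y_def)
    then have "1 \<le> nat \<lfloor>y\<rfloor>" by linarith
    moreover have "2 \<le> 16 * q" using q4 by simp
    ultimately obtain j where j: "(16 * q) ^ j \<le> nat \<lfloor>y\<rfloor>" "nat \<lfloor>y\<rfloor> < (16 * q) ^ (j + 1)"
      using ex_power_ivl1 by blast
    have "real ((16 * q) ^ j) \<le> real (nat \<lfloor>y\<rfloor>)" using j(1) by (rule of_nat_mono)
    then have j1: "real ((16 * q) ^ j) \<le> y" using y1 by linarith
    have "Suc (nat \<lfloor>y\<rfloor>) \<le> (16 * q) ^ (j + 1)" using j(2) by simp
    then have "real (Suc (nat \<lfloor>y\<rfloor>)) \<le> real ((16 * q) ^ (j + 1))" by (rule of_nat_mono)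
    then have j2: "y \<le> real ((16 * q) ^ (j + 1))" by linarith
    let ?H = "2 * q * (16 * q) ^ j"
    have "real ?H = 2 * real q * real ((16 * q) ^ j)" by simp
    also have "\<dots> \<le> 2 * real q * y" by (intro mult_left_mono j1) simp
    also have "\<dots> = real r * exp (- x)" using q4 by (simp add: y_def)
    finally have H: "real ?H \<le> real r * exp (- x)" .
    have "2 * exp (- x) \<le> 1" using elim(1) by (simp add: x_def exp_minus field_simps)
    then have "real r * (2 * exp (- x)) \<le> real r * 1" by (intro mult_left_mono) auto
    then have "2 * real ?H \<le> real r" using H by linarith
    then have c2: "2 * ?H \<le> r" by linarith
    have c3: "real (2 * (nat \<lceil>24 * ln (real r)\<rceil> * (A * ?H))) \<le> real r / (4 * (log 2 (real r) + 1)\<^sup>2)"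
    proof -
      let ?g = "4 * (log 2 (real r) + 1)\<^sup>2"
      have "0 < log 2 (real r)" using r by simp
      then have g: "0 < ?g" by simp
      have "real (nat \<lceil>24 * ln (real r)\<rceil>) \<le> 24 * ln (real r) + 1" using lnr by linarith
      then have "real (nat \<lceil>24 * ln (real r)\<rceil>) * (real A * real ?H) \<le> (24 * ln (real r) + 1) * (real A * (real r * exp (- x)))"
        using H lnr by (intro mult_mono mult_left_mono) auto
      moreover have "real (2 * (nat \<lceil>24 * ln (real r)\<rceil> * (A * ?H))) = 2 * (real (nat \<lceil>24 * ln (real r)\<rceil>) * (real A * real ?H))"
        by (simp only: of_nat_mult of_nat_numeral)
      ultimately have "real (2 * (nat \<lceil>24 * ln (real r)\<rceil> * (A * ?H))) \<le> 2 * ((24 * ln (real r) + 1) * (real A * (real r * exp (- x))))"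
        by linarith
      also have "\<dots> = real r * (real A * (2 * (24 * ln (real r) + 1) * exp (- x) * ?g)) / ?g"
        using g by (simp add: field_simps)
      also have "\<dots> \<le> real r * 1 / ?g"
        using elim(3) g unfolding x_def[symmetric] by (intro divide_right_mono mult_left_mono) auto
      finally show ?thesis by simp
    qed
    have c4: "real r * exp (- 8 * x) \<le> real (q ^ j)"
    proof -
      have "exp x ^ j \<le> real q ^ j" using q1 by (intro power_mono) auto
      moreover have "q ^ j \<le> ?H"
      proof -
        have "q ^ j \<le> (16 * q) ^ j" by (intro power_mono) auto
        also have "\<dots> \<le> ?H" using q4 by simp
        finally show ?thesis .
      qed
      then have "real q ^ j \<le> real r" using c2 by (metis add_leE mult_2 of_nat_mono of_nat_power order_trans)
      ultimately have "exp x ^ j \<le> real r" by (rule order_trans)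
      then have "exp (real j * x) \<le> exp (x * x)" unfolding exx by (simp only: exp_of_nat_mult)
      \<comment> \<open>From \<open>exp (j * x)\<close> being at most \<open>q ^ j\<close>, hence at
        most \<open>r = exp (x * x)\<close>.\<close>
      then have "real j \<le> x" using x(1) by simp
      have "16 \<le> exp (4::real)"
      proof -
        have "(2::real) \<le> exp 1" using exp_ge_add_one_self[of 1] by simp
        then have "(2::real) ^ 4 \<le> exp 1 ^ 4" by (intro power_mono) auto
        then show ?thesis by (simp flip: exp_of_nat_mult)
      qed
      then have "16 ^ j \<le> exp (4::real) ^ j" by (intro power_mono) auto
      also have "\<dots> = exp (real j * 4)" by (simp add: exp_of_nat_mult)
      also have "\<dots> \<le> exp (4 * x)" using \<open>real j \<le> x\<close> by simp
      finally have sixteen: "16 ^ j \<le> exp (4 * x)" .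
      have "real q * real q \<le> (2 * exp x) * (2 * exp x)" using q2 by (intro mult_mono) auto
      moreover have "exp (2 * x) = exp x * exp x" by (simp flip: exp_add)
      ultimately have qq: "real q * real q \<le> 4 * exp (2 * x)" by simp
      have e6: "exp (6 * x) = exp (2 * x) * exp (4 * x)" and e7: "exp (7 * x) = exp x * exp (6 * x)"
        and e8: "exp (- 8 * x) = exp (- x) * exp (- 7 * x)"
        by (simp_all flip: exp_add)
      \<comment> \<open>The exponent 8 is \<open>1 + 2 + 4 + 1\<close>: the factor
        \<open>exp (- x)\<close> in the scale, \<open>q * q\<close> from the initial scale and from
        rounding \<open>j\<close>, the powers \<open>16 ^ j\<close>, and one more
        \<open>exp x\<close> absorbing the constant 128.\<close>
      have "real r * exp (- x) = 2 * real q * y" using q4 by (simp add: y_def)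
      also have "\<dots> \<le> 2 * real q * real ((16 * q) ^ (j + 1))" by (intro mult_left_mono j2) auto
      also have "\<dots> = 32 * (real q * real q) * 16 ^ j * real (q ^ j)" by (simp add: power_mult_distrib)
      also have "\<dots> \<le> 32 * (4 * exp (2 * x)) * exp (4 * x) * real (q ^ j)"
        by (intro mult_right_mono mult_mono mult_left_mono qq sixteen) auto
      also have "\<dots> = 128 * exp (6 * x) * real (q ^ j)" by (simp only: e6)
      also have "\<dots> \<le> exp x * exp (6 * x) * real (q ^ j)"
        using elim(1) unfolding x_def[symmetric] by (intro mult_right_mono) auto
      also have "\<dots> = exp (7 * x) * real (q ^ j)" by (simp only: e7)
      finally have "real r * exp (- x) * exp (- 7 * x) \<le> exp (7 * x) * real (q ^ j) * exp (- 7 * x)"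
        by (intro mult_right_mono) auto
      moreover have "exp (7 * x) * real (q ^ j) * exp (- 7 * x) = real (q ^ j)"
        by (simp add: exp_minus)
      moreover have "real r * exp (- x) * exp (- 7 * x) = real r * exp (- 8 * x)"
        by (simp only: e8 mult.assoc)
      ultimately show ?thesis by (simp only:)
    qed
    from q4 c2 c3 c4 show ?case unfolding x_def by blast
  qed
qed

text \<open>Since \<open>ln (3 / 4)\<close> is at most \<open>- 1 / 4\<close>, the factor 24 gives
  the power 6. Cutting the density at \<open>r ^ 3\<close> then leaves a term of order
  \<open>1 / r ^ 3\<close>.\<close>

lemma three_quarters_power_le:
  fixes r :: real
  assumes "1 \<le> r"
  shows "(3 / 4) ^ nat \<lceil>24 * ln r\<rceil> \<le> 1 / r ^ 6"
proof -
  let ?B = "nat \<lceil>24 * ln r\<rceil>"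
  have "ln (3 / 4 :: real) \<le> - 1 / 4" using ln_le_minus_one[of "3 / 4"] by simp
  then have "real ?B * ln (3 / 4) \<le> real ?B * (- 1 / 4)" by (intro mult_left_mono) auto
  also have "\<dots> \<le> - 6 * ln r" by linarith
  finally have "exp (real ?B * ln (3 / 4)) \<le> exp (- 6 * ln r)" by simp
  moreover have "exp (real ?B * ln (3 / 4)) = (3 / 4) ^ ?B" by (simp add: exp_of_nat_mult)
  moreover have "exp (- 6 * ln r) = 1 / r ^ 6"
  proof -
    have "exp (6 * ln r) = r ^ 6" using assms exp_of_nat_mult[of 6 "ln r"] by simp
    then show ?thesis by (simp add: exp_minus field_simps)
  qed
  ultimately show ?thesis by simp
qed

context surviving_tree
begin

text \<open>The maximal inequality from level \<open>2 ^ k\<close> on, with threshold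
  \<open>2 ^ k / (k + 1)\<^sup>2\<close>, fails with probability at most a constant times
  \<open>1 / (k + 1)\<^sup>2\<close>, which is summable. Heights between \<open>2 ^ k\<close> and
  \<open>2 ^ (k + 1)\<close> lose a factor 2.\<close>

lemma AE_level_lower_bound:
  "AE \<omega> in M. \<forall>\<^sub>F h in sequentially. real h / (2 * (log 2 (real h) + 1)\<^sup>2) \<le> real (card (level h (T \<omega>)))"
proof -
  define \<theta> where "\<theta> k = 2 ^ k / (real k + 1)\<^sup>2" for k
  define small where "small k = {\<omega> \<in> space M. \<exists>h\<ge>2 ^ k. real (card (level h (T \<omega>))) \<le> \<theta> k}" for k
  have sets: "small k \<in> sets M" for k
  proof -
    have "small k = (\<Union>h\<in>{2 ^ k..}. {\<omega> \<in> space M. real (card (level h (truncate_tree h (T \<omega>)))) \<le> \<theta> k})"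
      by (auto simp: small_def level_truncate_tree)
    also have "\<dots> \<in> sets M" by (intro sets.countable_UN'' sets_surviving) auto
    finally show ?thesis .
  qed
  have bound: "measure M (small k) \<le> 1 / \<kappa> * (1 / (real (Suc k))\<^sup>2)" for k
  proof -
    have "emeasure M (small k) \<le> ennreal (\<theta> k / (1 + \<kappa> * real (2 ^ k)))"
      unfolding small_def by (rule prob_level_small) (simp add: \<theta>_def)
    then have "measure M (small k) \<le> \<theta> k / (1 + \<kappa> * real (2 ^ k))"
      using \<kappa> by (simp add: emeasure_eq_measure \<theta>_def)
    also have "\<dots> \<le> \<theta> k / (\<kappa> * 2 ^ k)"
      using \<kappa> by (intro divide_left_mono) (auto simp: \<theta>_def add_pos_pos)
    also have "\<dots> = 1 / \<kappa> * (1 / (real (Suc k))\<^sup>2)" using \<kappa> by (simp add: \<theta>_def add.commute)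
    finally show ?thesis .
  qed
  have "summable (\<lambda>k. 1 / (real (Suc k))\<^sup>2)"
    using inverse_power_summable[of 2, where 'a = real] summable_Suc_iff[of "\<lambda>k. inverse ((real k)\<^sup>2)"]
    by (simp add: inverse_eq_divide)
  then have "summable (\<lambda>k. 1 / \<kappa> * (1 / (real (Suc k))\<^sup>2))" by (rule summable_mult)
  then have "summable (\<lambda>k. measure M (small k))"
    by (rule summable_comparison_test'[where N = 0]) (use bound in auto)
  then have "AE \<omega> in M. \<forall>\<^sub>F k in sequentially. \<omega> \<in> space M - small k"
    using sets by (intro borel_cantelli_AE1) (auto simp: emeasure_eq_measure)
  then show ?thesis
  proof (rule AE_mp, intro AE_I2 impI)
    fix \<omega> assume "\<forall>\<^sub>F k in sequentially. \<omega> \<in> space M - small k"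
    then obtain k0 where k0: "\<And>k. k0 \<le> k \<Longrightarrow> \<omega> \<in> space M - small k"
      by (auto simp: eventually_sequentially)
    show "\<forall>\<^sub>F h in sequentially. real h / (2 * (log 2 (real h) + 1)\<^sup>2) \<le> real (card (level h (T \<omega>)))"
      unfolding eventually_sequentially
    proof (intro exI[of _ "2 ^ k0"] allI impI)
      fix h :: nat assume h: "2 ^ k0 \<le> h"
      have h1: "1 \<le> h" using h order_trans[OF one_le_power[of "2::nat" k0]] by simp
      then obtain k where k: "2 ^ k \<le> h" "h < 2 ^ (k + 1)" using ex_power_ivl1[of 2 h] by auto
      have "(2::nat) ^ k0 < 2 ^ (k + 1)" using h k(2) by linarith
      then have "k0 < k + 1" by (rule power_less_imp_less_exp[rotated]) simp
      then have "k0 \<le> k" by simp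
      with k0[of k] k(1) have "\<theta> k < real (card (level h (T \<omega>)))" by (force simp: small_def)
      moreover have "real h / (2 * (log 2 (real h) + 1)\<^sup>2) \<le> \<theta> k"
      proof -
        have "real k \<le> log 2 (real h)" using k(1) by (rule le_log2_of_power)
        then have "(real k + 1)\<^sup>2 \<le> (log 2 (real h) + 1)\<^sup>2" by (intro power_mono) auto
        moreover have "real h \<le> real (2 ^ (k + 1))" using k(2) by (intro of_nat_mono) simp
        then have "real h / 2 \<le> 2 ^ k" by simp
        ultimately have "real h / 2 / (log 2 (real h) + 1)\<^sup>2 \<le> 2 ^ k / (real k + 1)\<^sup>2"
          by (intro frac_le) auto
        then show ?thesis by (simp add: \<theta>_def)
      qed
      ultimately show "real h / (2 * (log 2 (real h) + 1)\<^sup>2) \<le> real (card (level h (T \<omega>)))" by linarith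
    qed
  qed
qed

text \<open>A second use of Borel-Cantelli, now over \<open>r\<close> itself: almost surely every
  large level \<open>r - H r\<close> that holds enough blocks can be split into two wide parts. The
  lower bound on level sizes supplies enough blocks.\<close>

lemma AE_girth_lower_bound:
  "AE \<omega> in M. \<forall>\<^sub>F r in sequentially. 1 / real r * real (girth r (T \<omega>)) \<ge> exp (- 8 * sqrt (ln (real r)))"
proof -
  define A where "A = Suc (nat \<lceil>32 * \<sigma>2\<rceil>)"
  have A: "0 < A" "32 * \<sigma>2 \<le> real A" unfolding A_def by linarith+
  define B where "B r = nat \<lceil>24 * ln (real r)\<rceil>" for r
  have "\<forall>\<^sub>F r in sequentially. 1 \<le> r \<and> (\<exists>q j. 4 \<le> q \<and> 2 * (2 * q * (16 * q) ^ j) \<le> r \<and>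
    real (2 * (B r * (A * (2 * q * (16 * q) ^ j)))) \<le> real r / (4 * (log 2 (real r) + 1)\<^sup>2) \<and>
    real r * exp (- 8 * sqrt (ln (real r))) \<le> real (q ^ j))"
    using eventually_ge_at_top eventually_scale_parameters[of A] unfolding B_def by (rule eventually_conj)
  then obtain r0 where r0: "\<And>r. r0 \<le> r \<Longrightarrow> 1 \<le> r \<and> (\<exists>q j. 4 \<le> q \<and> 2 * (2 * q * (16 * q) ^ j) \<le> r \<and>
    real (2 * (B r * (A * (2 * q * (16 * q) ^ j)))) \<le> real r / (4 * (log 2 (real r) + 1)\<^sup>2) \<and>
    real r * exp (- 8 * sqrt (ln (real r))) \<le> real (q ^ j))"
    unfolding eventually_sequentially by blast
  have "\<exists>q j. r0 \<le> r \<longrightarrow> 4 \<le> q \<and> 2 * (2 * q * (16 * q) ^ j) \<le> r \<and>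
    real (2 * (B r * (A * (2 * q * (16 * q) ^ j)))) \<le> real r / (4 * (log 2 (real r) + 1)\<^sup>2) \<and>
    real r * exp (- 8 * sqrt (ln (real r))) \<le> real (q ^ j)" for r
    using r0 by blast
  then obtain q j where qj: "\<And>r. r0 \<le> r \<Longrightarrow> 4 \<le> q r \<and> 2 * (2 * q r * (16 * q r) ^ j r) \<le> r \<and>
    real (2 * (B r * (A * (2 * q r * (16 * q r) ^ j r)))) \<le> real r / (4 * (log 2 (real r) + 1)\<^sup>2) \<and>
    real r * exp (- 8 * sqrt (ln (real r))) \<le> real (q r ^ j r)"
    by metis
  define H where "H r = 2 * q r * (16 * q r) ^ j r" for r
  define l where "l r = q r ^ j r" for r
  \<comment> \<open>Level \<open>r\<close> becomes the middle of the strip of height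
    \<open>2 * H r\<close>, as the girth bound requires.\<close>
  define h where "h r = r - H r" for r
  define bad where "bad r = (if r0 \<le> r then {\<omega> \<in> space M. 2 * (B r * (A * H r)) \<le> card (level (h r) (T \<omega>)) \<and>
    \<not> split_wide (T \<omega>) (h r) (h r + 2 * H r) (l r)} else {})" for r
  have H: "2 * H r \<le> r" "h r + H r = r" "l r \<le> H r" "1 \<le> r"
    "real (2 * (B r * (A * H r))) \<le> real r / (4 * (log 2 (real r) + 1)\<^sup>2)"
    "real r * exp (- 8 * sqrt (ln (real r))) \<le> real (l r)" if "r0 \<le> r" for r
  proof -
    show "2 * H r \<le> r" "1 \<le> r" "real (2 * (B r * (A * H r))) \<le> real r / (4 * (log 2 (real r) + 1)\<^sup>2)"
      "real r * exp (- 8 * sqrt (ln (real r))) \<le> real (l r)"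
      using qj[OF that] r0[OF that] unfolding H_def l_def by blast+
    then show "h r + H r = r" unfolding h_def by simp
    have "l r \<le> (16 * q r) ^ j r" unfolding l_def by (intro power_mono) auto
    also have "\<dots> \<le> H r" unfolding H_def using qj[OF that] by simp
    finally show "l r \<le> H r" .
  qed
  have bad_sets: "bad r \<in> sets M" for r
  proof -
    have "{\<omega> \<in> space M. 2 * (B r * (A * H r)) \<le> card (level (h r) (T \<omega>)) \<and>
        \<not> split_wide (T \<omega>) (h r) (h r + 2 * H r) (l r)} \<in> sets M"
      using sets_surviving[of "\<lambda>X. 2 * (B r * (A * H r)) \<le> card (level (h r) X) \<and>
        \<not> split_wide X (h r) (h r + 2 * H r) (l r)" "h r + 2 * H r"]
      by (simp add: level_truncate_tree split_wide_truncate_tree)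
    then show ?thesis by (simp add: bad_def)
  qed
  have bad_bound: "measure M (bad r) \<le> (5 + 2 * \<sigma>2) * (1 / (real r)\<^sup>2)" for r
  proof (cases "r0 \<le> r")
    case True
    have r1: "1 \<le> real r" using H(4)[OF True] by simp
    have scale: "good_scale A (H r) (l r)"
      unfolding H_def l_def using qj[OF True] A by (intro good_scale_iterate) auto
    \<comment> \<open>The density is cut at \<open>r ^ 3\<close>: the first term becomes of order
      \<open>1 / r ^ 3\<close>, and the second, from the linearly growing second moment, of order
      \<open>1 / r\<^sup>2\<close>. Both are summable.\<close>
    have "measure M (bad r) \<le> real r ^ 3 * (4 * (3 / 4) ^ B r) + (1 + \<sigma>2 * real (h r + 2 * H r)) / real r ^ 3"
      using True r1 prob_not_split_wide[OF scale, of "real r ^ 3" "B r" "h r"] by (simp add: bad_def)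
    also have "\<dots> \<le> real r ^ 3 * (4 * (1 / real r ^ 6)) + (1 + \<sigma>2 * (2 * real r)) / real r ^ 3"
    proof (intro add_mono mult_left_mono divide_right_mono)
      show "(3 / 4) ^ B r \<le> 1 / real r ^ 6" unfolding B_def by (rule three_quarters_power_le[OF r1])
      show "real (h r + 2 * H r) \<le> 2 * real r" using H(1,2)[OF True] by linarith
    qed (use \<sigma>2 in auto)
    also have "\<dots> = 4 / real r ^ 3 + (1 / real r ^ 3 + 2 * \<sigma>2 / (real r)\<^sup>2)"
      using r1 by (simp add: field_simps power_numeral_reduce)
    also have "\<dots> \<le> 4 / (real r)\<^sup>2 + (1 / (real r)\<^sup>2 + 2 * \<sigma>2 / (real r)\<^sup>2)"
      using r1 power_increasing[of 2 3 "real r"] by (intro add_mono divide_left_mono order_refl) auto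
    also have "\<dots> = (5 + 2 * \<sigma>2) * (1 / (real r)\<^sup>2)" by (simp add: add_divide_distrib)
    finally show ?thesis .
  qed (use \<sigma>2 in \<open>simp add: bad_def\<close>)
  have "summable (\<lambda>r. (5 + 2 * \<sigma>2) * (1 / (real r)\<^sup>2))"
    using inverse_power_summable[of 2, where 'a = real] by (intro summable_mult) (simp add: inverse_eq_divide)
  then have "summable (\<lambda>r. measure M (bad r))"
    by (rule summable_comparison_test'[where N = 0]) (use bad_bound in auto)
  then have "AE \<omega> in M. \<forall>\<^sub>F r in sequentially. \<omega> \<in> space M - bad r"
    using bad_sets by (intro borel_cantelli_AE1) (auto simp: emeasure_eq_measure)
  then show ?thesis
    using AE_level_lower_bound
  proof eventually_elim
    case (elim \<omega>)
    from elim(2) obtain h1 where h1: "\<And>h. h1 \<le> h \<Longrightarrow>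
        real h / (2 * (log 2 (real h) + 1)\<^sup>2) \<le> real (card (level h (T \<omega>)))"
      by (auto simp: eventually_sequentially)
    have "\<forall>\<^sub>F r in sequentially. r0 \<le> r \<and> 2 * h1 \<le> r \<and> 2 \<le> r"
      by (intro eventually_conj eventually_ge_at_top)
    with elim(1) show ?case
    proof eventually_elim
      case (elim r)
      then have r: "r0 \<le> r" "2 * h1 \<le> r" "2 \<le> r" and \<omega>: "\<omega> \<in> space M" "\<omega> \<notin> bad r" by auto
      have "r \<le> 2 * h r" "h r \<le> r" using H(1)[OF r(1)] unfolding h_def by auto
      \<comment> \<open>As \<open>h r\<close> is at least \<open>r / 2\<close>, the level bound at
        \<open>h r\<close> holds with \<open>r\<close> in place of \<open>h r\<close> and the
        constant 4 in place of 2.\<close>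
      then have hr: "h1 \<le> h r" "1 \<le> h r" "real r / 2 \<le> real (h r)" "real (h r) \<le> real r"
        using r by auto
      have "log 2 (real (h r)) \<le> log 2 (real r)" "0 \<le> log 2 (real (h r))" using hr by auto
      then have "(log 2 (real (h r)) + 1)\<^sup>2 \<le> (log 2 (real r) + 1)\<^sup>2" "0 < (log 2 (real (h r)) + 1)\<^sup>2"
        by (auto intro!: power_mono)
      then have "(real r / 2) / (2 * (log 2 (real r) + 1)\<^sup>2) \<le> real (h r) / (2 * (log 2 (real (h r)) + 1)\<^sup>2)"
        using hr by (intro frac_le) auto
      also have "\<dots> \<le> real (card (level (h r) (T \<omega>)))" by (rule h1[OF hr(1)])
      finally have "real r / (4 * (log 2 (real r) + 1)\<^sup>2) \<le> real (card (level (h r) (T \<omega>)))" by simp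
      with H(5)[OF r(1)] have "real (2 * (B r * (A * H r))) \<le> real (card (level (h r) (T \<omega>)))" by linarith
      then have "2 * (B r * (A * H r)) \<le> card (level (h r) (T \<omega>))" by linarith
      then have "split_wide (T \<omega>) (h r) (h r + 2 * H r) (l r)"
        using \<omega> r(1) by (simp add: bad_def)
      then obtain S1 S2 where S: "level (h r) (T \<omega>) = S1 \<union> S2" "\<And>u v. u \<in> S1 \<Longrightarrow> v \<in> S2 \<Longrightarrow> u \<lhd> v"
        "wide (descendants (T \<omega>) S1 (h r)) (h r) (h r + 2 * H r) (l r)"
        "wide (descendants (T \<omega>) S2 (h r)) (h r) (h r + 2 * H r) (l r)"
        unfolding split_wide_def by blast
      have "T \<omega> \<in> space tree_space"
        using surviving \<omega>(1) unfolding GW_surviving_def by (auto dest: measurable_space)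
      then have tree: "plane_tree (T \<omega>)" "locally_finite (T \<omega>)"
        unfolding tree_space_def by (auto simp: space_measure_of_conv)
      have "l r \<le> girth r (T \<omega>)"
        using girth_ge_of_wide[OF tree S] H(2,3)[OF r(1)] by simp
      then have "real r * exp (- 8 * sqrt (ln (real r))) \<le> real (girth r (T \<omega>))"
        using H(6)[OF r(1)] by linarith
      then show ?case using r(3) by (simp add: field_simps)
    qed
  qed
qed

end

section \<open>Bernoulli bounds and the constants of the offspring law\<close>

lemma one_minus_power_ge:
  fixes q :: real
  assumes "0 \<le> q" "q \<le> 1"
  shows "1 - real k * q \<le> (1 - q) ^ k"
  using Bernoulli_inequality[of "- q" k] assms by simp

text \<open>The Bernoulli inequality with its quadratic gain for \<open>k\<close> at least 2; this
  gain is the source of \<open>\<kappa>\<close>.\<close>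

lemma one_minus_power_ge_square:
  fixes q :: real
  assumes "0 \<le> q" "q \<le> 1" "2 \<le> k"
  shows "1 - real k * q + q\<^sup>2 \<le> (1 - q) ^ k"
  using assms(3)
proof (induction k rule: dec_induct)
  case base
  show ?case by (simp add: power2_eq_square algebra_simps)
next
  case (step n)
  have "1 - real (Suc n) * q + q\<^sup>2 \<le> (1 - q) * (1 - real n * q + q\<^sup>2)"
  proof -
    have "q * q\<^sup>2 \<le> 1 * q\<^sup>2" using assms by (intro mult_right_mono) auto
    also have "\<dots> \<le> real n * q\<^sup>2" using step by (intro mult_right_mono) auto
    finally show ?thesis by (simp add: algebra_simps power2_eq_square)
  qed
  also have "\<dots> \<le> (1 - q) * (1 - q) ^ n" using assms step.IH by (intro mult_left_mono) auto
  finally show ?case by simp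
qed

text \<open>If only 0 and 1 had mass, the second moment would equal the mean and the variance would
  vanish. So some \<open>k0\<close> at least 2 has positive mass; averaging the Bernoulli bounds,
  with the quadratic gain used at \<open>k0\<close> only, gives the generating function bound with
  \<open>\<kappa> = pmf \<mu> k0\<close>.\<close>

lemma critical_offspring_exists:
  fixes \<mu> :: "nat pmf"
  assumes int: "integrable (measure_pmf \<mu>) (\<lambda>k. real k)"
    and mean: "measure_pmf.expectation \<mu> (\<lambda>k. real k) = 1"
    and int2: "integrable (measure_pmf \<mu>) (\<lambda>k. (real k)\<^sup>2)"
    and var: "measure_pmf.variance \<mu> (\<lambda>k. real k) \<noteq> 0"
  shows "\<exists>\<sigma>2 \<kappa>. critical_offspring \<mu> \<sigma>2 \<kappa>"
proof -
  let ?E = "measure_pmf.expectation \<mu>"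
  define \<sigma>2 where "\<sigma>2 = measure_pmf.variance \<mu> (\<lambda>k. real k)"
  have \<sigma>2: "?E (\<lambda>k. (real k)\<^sup>2) = 1 + \<sigma>2"
    unfolding \<sigma>2_def using measure_pmf.variance_eq[OF int int2] mean by simp
  have "0 \<le> \<sigma>2" unfolding \<sigma>2_def by (rule measure_pmf.variance_positive)
  have "\<exists>k\<in>set_pmf \<mu>. 2 \<le> k"
  proof (rule ccontr)
    assume "\<not> ?thesis"
    then have "(real k)\<^sup>2 = real k" if "k \<in> set_pmf \<mu>" for k
      using that by (cases "k = 0 \<or> k = 1") force+
    then have "?E (\<lambda>k. (real k)\<^sup>2) = ?E (\<lambda>k. real k)"
      by (intro integral_cong_AE) (auto simp: AE_measure_pmf_iff)
    then show False using \<sigma>2 mean var by (simp add: \<sigma>2_def)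
  qed
  then obtain k0 where k0: "k0 \<in> set_pmf \<mu>" "2 \<le> k0" by blast
  define \<kappa> where "\<kappa> = pmf \<mu> k0"
  have \<kappa>: "0 < \<kappa>" "\<kappa> \<le> 1" using k0(1) by (simp_all add: \<kappa>_def pmf_positive pmf_le_1)
  have "critical_offspring \<mu> \<sigma>2 \<kappa>"
  proof
    show "(\<integral>\<^sup>+ k. ennreal (real k) \<partial>\<mu>) = 1" using nn_integral_eq_integral[OF int] mean by simp
    show "(\<integral>\<^sup>+ k. ennreal ((real k)\<^sup>2) \<partial>\<mu>) = ennreal (1 + \<sigma>2)"
      using nn_integral_eq_integral[OF int2] \<sigma>2 by simp
  next
    fix q :: real assume q: "0 \<le> q" "q \<le> 1"
    have int_pow: "integrable (measure_pmf \<mu>) (\<lambda>k. (1 - q) ^ k)"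
      using q by (intro measure_pmf.integrable_const_bound[where B = 1]) (auto simp: power_le_one)
    have int_ind: "integrable (measure_pmf \<mu>) (\<lambda>k. indicator {k0} k :: real)"
      by (rule measure_pmf.integrable_const_bound[where B = 1]) auto
    have "?E (\<lambda>k. 1 - real k * q + indicator {k0} k * q\<^sup>2) = 1 - q + \<kappa> * q\<^sup>2"
      using int mean int_ind by (simp add: \<kappa>_def measure_pmf_single)
    moreover have "?E (\<lambda>k. 1 - real k * q + indicator {k0} k * q\<^sup>2) \<le> ?E (\<lambda>k. (1 - q) ^ k)"
      using int int_ind int_pow one_minus_power_ge[OF q] one_minus_power_ge_square[OF q k0(2)]
      by (intro integral_mono) (auto simp: indicator_def)
    ultimately have "ennreal (1 - q + \<kappa> * q\<^sup>2) \<le> ennreal (?E (\<lambda>k. (1 - q) ^ k))"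
      by (intro ennreal_leI) simp
    also have "\<dots> = (\<integral>\<^sup>+ k. ennreal ((1 - q) ^ k) \<partial>\<mu>)"
      using q by (intro nn_integral_eq_integral[symmetric] int_pow) simp
    finally show "ennreal (1 - q + \<kappa> * q\<^sup>2) \<le> (\<integral>\<^sup>+ k. ennreal ((1 - q) ^ k) \<partial>\<mu>)" .
  qed (use \<open>0 \<le> \<sigma>2\<close> \<kappa> in auto)
  then show ?thesis by blast
qed

theorem proposition3:
  fixes \<mu> :: "nat pmf" and M :: "'a measure" and T :: "'a \<Rightarrow> nat list set"
  assumes "integrable (measure_pmf \<mu>) (\<lambda>k. real k)"
    and "measure_pmf.expectation \<mu> (\<lambda>k. real k) = 1"
    and "integrable (measure_pmf \<mu>) (\<lambda>k. (real k)\<^sup>2)"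
    and "measure_pmf.variance \<mu> (\<lambda>k. real k) \<noteq> 0"
    and "prob_space M"
    and "GW_surviving \<mu> M T"
  shows "\<exists>C::real. AE \<omega> in M. \<forall>\<^sub>F r in sequentially.
           1 / real r * real (girth r (T \<omega>)) \<ge> exp (- C * sqrt (ln (real r)))"
proof -
  obtain \<sigma>2 \<kappa> where "critical_offspring \<mu> \<sigma>2 \<kappa>"
    using critical_offspring_exists[OF assms(1-4)] by blast
  then interpret surviving_tree \<mu> \<sigma>2 \<kappa> M T
    using assms(5,6) by (simp add: surviving_tree_def surviving_tree_axioms_def)
  \<comment> \<open>The constant is \<open>C = 8\<close> for every offspring law.\<close>
  show ?thesis using AE_girth_lower_bound by blast
qed

end
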